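(* The homomorphism $P:M_\infty\to\mathbb{Z}_2^\times$, $\sigma\mapsto P(\sigma,x_0)$, is surjective, and there is a short exact sequence \[ 0\to\overline{B}_\infty\to M_\infty\xrightarrow{P}\mathbb{Z}_2^\times\to0. \] In addition, for each $n\ge1$, with $j:=\lfloor(n+1)/2\rfloor$, there is a short exact sequence \[ 0\to B_n\to M_n\xrightarrow{P}(\mathbb{Z}/2^j\mathbb{Z})^\times\to0, \] where $P(\sigma)=P(\sigma,x_0)$. Moreover, $|M_n|=2^{m_n}$, where \[ m_n=\frac{2^{n+1}}{3}+n-\begin{cases}5/3 & n\text{ even},\\ 4/3 & n\text{ odd}.\end{cases} \]
   Context: $T_\infty$ is the infinite binary rooted tree whose nodes at level $m\ge0$ are words of length $m$ over $\{a,b\}$ (root $x_0$ = empty word), each $w$ joined to $wa,wb$; $T_n$ the subtree of words of length $\le n$; $\mathrm{Aut}(T_\infty),\mathrm{Aut}(T_n)$ the root-preserving automorphism groups; $\mathrm{Aut}(T_\infty)$ carries the profinite topology whose basic open sets are cosets of the subgroups fixing all nodes of length $\le m$. $\mathrm{Par}(\sigma,x)=0$ if $\sigma(xa)=\sigma(x)a$ and $\sigma(xb)=\sigma(x)b$, and $=1$ if $\sigma(xa)=\sigma(x)b$ and $\sigma(xb)=\sigma(x)a$. For $\sigma\in\mathrm{Aut}(T_\infty)$: $Q(\sigma,x):=\sum_{i\ge0}2^i\sum_{s_1,\ldots,s_i\in\{a,b\}}\mathrm{Par}(\sigma,x\,a\,s_1\,a\,s_2\cdots a\,s_i)\in\mathbb{Z}_2$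 (concatenated words), $P(\sigma,x):=(-1)^{\mathrm{Par}(\sigma,x)}+2\sum_{t\in\{a,b\}}Q(\sigma,xbt)-2\sum_{t\in\{a,b\}}Q(\sigma,xat)\in\mathbb{Z}_2^\times$. For $\tau\in\mathrm{Aut}(T_n)$ and $x$ of length $m\le n$, $P(\tau,x):=P(\tilde\tau,x)\bmod 2^{\lfloor(n-m+1)/2\rfloor}$ for any extension $\tilde\tau$ of $\tau$ to $T_\infty$. $M_\infty:=\{\sigma\in\mathrm{Aut}(T_\infty):P(\sigma,x)=P(\sigma,x_0)\ \forall x\}$; $M_n:=\{\sigma\in\mathrm{Aut}(T_n):$ for all $m\ge0$ and words $x$ of length $m$, $P(\sigma,x)\equiv P(\sigma,x_0)\pmod{2^{\lfloor(n-m+1)/2\rfloor}}\}$. Basilica group: $\boldsymbol\alpha,\boldsymbol\beta\in\mathrm{Aut}(T_\infty)$ are defined by $\mathrm{Par}(\boldsymbol\alpha,b^k)=1$ for even $k\ge0$ ($b^k$ the word of $k$ letters $b$), $\mathrm{Par}(\boldsymbol\beta,b^k)=1$ for odd $k$, and $\mathrm{Par}=0$ at all other nodes for both. $B_\infty:=\langle\boldsymbol\alpha,\boldsymbol\beta\rangle$, $\overline{B}_\infty$ its closure, $B_n$ its image under restriction to $T_n$. *)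

theory Defs
  imports
    "HOL-Analysis.Analysis"
    "HOL-Algebra.Bij"
    "HOL-Algebra.Generated_Groups"
    "HOL-Number_Theory.Residues"
begin

section \<open>The ring of 2-adic integers\<close>

text \<open>The inverse limit of the rings \<open>\<int>/2\<^sup>k\<int>\<close>. The defining condition also forces
  \<open>0 \<le> f k < 2 ^ k\<close>, so each element is a compatible family of reduced residues.\<close>

typedef z2adic = "{f :: nat \<Rightarrow> int. \<forall>k. f (Suc k) mod 2 ^ k = f k}"
  morphisms z2_res Abs_z2adic
  by (rule exI[of _ "\<lambda>_. 0"]) simp

lemma z2_res_Suc: "z2_res x (Suc k) mod 2 ^ k = z2_res x k"
  using z2_res[of x] by simp

lemma z2_res_mod [simp]: "z2_res x k mod 2 ^ k = z2_res x k"
  by (subst (1 2) z2_res_Suc [symmetric]) simp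

lemma z2adic_eqI: "(\<And>k. z2_res x k = z2_res y k) \<Longrightarrow> x = y"
  using z2_res_inject[of x y] by auto

lemma mod_pow2_Suc: "(a::int) mod 2 ^ Suc k mod 2 ^ k = a mod 2 ^ k"
  by (rule mod_mod_cancel) simp

lemma z2_res_Abs:
  assumes "\<And>k. g (Suc k) mod 2 ^ k = g k mod (2 ^ k :: int)"
  shows "z2_res (Abs_z2adic (\<lambda>k. g k mod 2 ^ k)) k = g k mod 2 ^ k"
proof -
  have "g (Suc k) mod 2 ^ Suc k mod 2 ^ k = g k mod 2 ^ k" for k
    by (simp only: mod_pow2_Suc assms)
  then show ?thesis
    by (subst Abs_z2adic_inverse) auto
qed

instantiation z2adic :: comm_ring_1
begin

definition "0 = Abs_z2adic (\<lambda>k. 0 mod 2 ^ k)"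
definition "1 = Abs_z2adic (\<lambda>k. 1 mod 2 ^ k)"
definition "x + y = Abs_z2adic (\<lambda>k. (z2_res x k + z2_res y k) mod 2 ^ k)"
definition "x * y = Abs_z2adic (\<lambda>k. (z2_res x k * z2_res y k) mod 2 ^ k)"
definition "- x = Abs_z2adic (\<lambda>k. (- z2_res x k) mod 2 ^ k)"
definition "x - y = Abs_z2adic (\<lambda>k. (z2_res x k - z2_res y k) mod 2 ^ k)"

lemma z2_res_zero [simp]: "z2_res 0 k = 0"
  unfolding zero_z2adic_def by (subst z2_res_Abs) auto

lemma z2_res_one: "z2_res 1 k = 1 mod 2 ^ k"
  unfolding one_z2adic_def by (subst z2_res_Abs) auto

lemma z2_res_add: "z2_res (x + y) k = (z2_res x k + z2_res y k) mod 2 ^ k"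
  unfolding plus_z2adic_def
  by (rule z2_res_Abs) (subst mod_add_eq [symmetric], simp only: z2_res_Suc)

lemma z2_res_mult: "z2_res (x * y) k = (z2_res x k * z2_res y k) mod 2 ^ k"
  unfolding times_z2adic_def
  by (rule z2_res_Abs) (subst mod_mult_eq [symmetric], simp only: z2_res_Suc)

lemma z2_res_uminus: "z2_res (- x) k = (- z2_res x k) mod 2 ^ k"
  unfolding uminus_z2adic_def
  by (rule z2_res_Abs) (subst mod_minus_eq [symmetric], simp only: z2_res_Suc)

lemma z2_res_diff: "z2_res (x - y) k = (z2_res x k - z2_res y k) mod 2 ^ k"
  unfolding minus_z2adic_def
  by (rule z2_res_Abs) (subst mod_diff_eq [symmetric], simp only: z2_res_Suc)

instance
proof
  fix a b c :: z2adic
  show "a * b * c = a * (b * c)"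
    by (rule z2adic_eqI) (simp add: z2_res_mult mod_simps ac_simps)
  show "a * b = b * a"
    by (rule z2adic_eqI) (simp add: z2_res_mult ac_simps)
  show "1 * a = a"
    by (rule z2adic_eqI) (metis mod_mult_left_eq mult_1 z2_res_mod z2_res_mult z2_res_one)
  show "a + b + c = a + (b + c)"
    by (rule z2adic_eqI) (simp add: z2_res_add mod_simps ac_simps)
  show "a + b = b + a"
    by (rule z2adic_eqI) (simp add: z2_res_add ac_simps)
  show "0 + a = a"
    by (rule z2adic_eqI) (simp add: z2_res_add)
  show "- a + a = 0"
    by (rule z2adic_eqI) (simp add: z2_res_add z2_res_uminus mod_simps)
  show "a - b = a + - b"
    by (rule z2adic_eqI) (simp add: z2_res_add z2_res_uminus z2_res_diff mod_simps)
  show "(a + b) * c = a * c + b * c"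
    by (rule z2adic_eqI) (simp add: z2_res_add z2_res_mult mod_simps distrib_right)
  have "z2_res 0 1 \<noteq> z2_res 1 1"
    by (simp add: z2_res_one)
  then show "(0::z2adic) \<noteq> 1" by metis
qed

end

text \<open>The 2-adic topology: the classes modulo \<open>2 ^ k\<close> form a basis of neighbourhoods.\<close>

instantiation z2adic :: t2_space
begin

definition open_z2adic :: "z2adic set \<Rightarrow> bool" where
  "open_z2adic U \<longleftrightarrow> (\<forall>x\<in>U. \<exists>k. \<forall>y. z2_res y k = z2_res x k \<longrightarrow> y \<in> U)"

lemma z2_res_le: "k \<le> l \<Longrightarrow> z2_res x l mod 2 ^ k = z2_res x k"
proof (induction l rule: dec_induct)
  case (step l)
  have "z2_res x (Suc l) mod 2 ^ l mod 2 ^ k = z2_res x (Suc l) mod 2 ^ k"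
    by (rule mod_mod_cancel) (rule le_imp_power_dvd[OF step.hyps(1)])
  then show ?case by (simp only: z2_res_Suc step.IH)
qed (rule z2_res_mod)

lemma open_z2_class: "open {y :: z2adic. z2_res y k = c}"
  unfolding open_z2adic_def by auto

instance
proof
  show "open (UNIV :: z2adic set)"
    by (simp add: open_z2adic_def)
next
  fix S T :: "z2adic set"
  assume S: "open S" and T: "open T"
  show "open (S \<inter> T)"
    unfolding open_z2adic_def
  proof
    fix x assume "x \<in> S \<inter> T"
    with S T obtain k l where
      k: "\<And>y. z2_res y k = z2_res x k \<Longrightarrow> y \<in> S" and
      l: "\<And>y. z2_res y l = z2_res x l \<Longrightarrow> y \<in> T"
      unfolding open_z2adic_def by blast
    have "y \<in> S \<inter> T" if "z2_res y (max k l) = z2_res x (max k l)" for y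
    proof -
      have "z2_res y k = z2_res x k" "z2_res y l = z2_res x l"
        using that z2_res_le[of k "max k l"] z2_res_le[of l "max k l"] by (metis max.cobounded1 max.cobounded2)+
      then show ?thesis using k l by blast
    qed
    then show "\<exists>m. \<forall>y. z2_res y m = z2_res x m \<longrightarrow> y \<in> S \<inter> T" by blast
  qed
next
  fix K :: "z2adic set set"
  assume "\<forall>S\<in>K. open S"
  then show "open (\<Union>K)"
    unfolding open_z2adic_def by (meson UnionE UnionI)
next
  fix x y :: z2adic
  assume "x \<noteq> y"
  then obtain k where k: "z2_res x k \<noteq> z2_res y k"
    using z2adic_eqI[of x y] by blast
  show "\<exists>U V. open U \<and> open V \<and> x \<in> U \<and> y \<in> V \<and> U \<inter> V = {}"
    by (rule exI[of _ "{z. z2_res z k = z2_res x k}"], rule exI[of _ "{z. z2_res z k = z2_res y k}"])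
       (use k in \<open>auto simp: open_z2_class\<close>)
qed

end

lemma z2_res_of_nat: "z2_res (of_nat n) k = int n mod 2 ^ k"
proof (induction n)
  case (Suc n)
  then show ?case
    by (simp only: of_nat_Suc z2_res_add z2_res_one mod_add_eq add.commute)
qed simp

lemma z2_res_pow2_mult: "k \<le> i \<Longrightarrow> z2_res (2 ^ i * x) k = 0"
proof -
  assume "k \<le> i"
  then have "(2::int) ^ k dvd 2 ^ i" by (rule le_imp_power_dvd)
  then have "z2_res (of_nat (2 ^ i)) k = 0"
    using z2_res_of_nat[of "2 ^ i" k] by (simp add: dvd_imp_mod_0)
  then have "z2_res (of_nat (2 ^ i) * x) k = 0"
    by (simp only: z2_res_mult mult_zero_left mod_0)
  then show ?thesis by (simp only: of_nat_power of_nat_numeral)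
qed

text \<open>Every series \<open>\<Sum>i. 2 ^ i * c i\<close> converges.\<close>

lemma z2_pow_sums: "(\<lambda>i. 2 ^ i * c i :: z2adic) sums Abs_z2adic (\<lambda>k. z2_res (\<Sum>i<k. 2 ^ i * c i) k)"
proof -
  let ?S = "\<lambda>n. \<Sum>i<n. 2 ^ i * c i"
  have eq: "z2_res (?S n) k = z2_res (?S k) k" if "k \<le> n" for n k
    using that
  proof (induction n rule: dec_induct)
    case (step n)
    then show ?case by (simp add: z2_res_add z2_res_pow2_mult)
  qed simp
  have S: "z2_res (?S (Suc k)) (Suc k) mod 2 ^ k = z2_res (?S k) k" for k
    using eq[of k "Suc k"] by (simp only: z2_res_Suc)
  have L: "z2_res (Abs_z2adic (\<lambda>k. z2_res (?S k) k)) = (\<lambda>k. z2_res (?S k) k)"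
    by (intro Abs_z2adic_inverse CollectI allI S)
  show ?thesis
    unfolding sums_def
  proof (rule topological_tendstoI)
    fix U assume U: "open U" and in_U: "Abs_z2adic (\<lambda>k. z2_res (?S k) k) \<in> U"
    have "\<exists>k. \<forall>y. z2_res y k = z2_res (?S k) k \<longrightarrow> y \<in> U"
      using bspec[OF U[unfolded open_z2adic_def] in_U] by (simp only: L)
    then obtain k where k: "\<And>y. z2_res y k = z2_res (?S k) k \<Longrightarrow> y \<in> U"
      by blast
    show "\<forall>\<^sub>F n in sequentially. ?S n \<in> U"
      using eventually_ge_at_top[of k] by eventually_elim (rule k, rule eq)
  qed
qed

definition z2_units :: "z2adic monoid" where
  "z2_units = units_of \<lparr>carrier = UNIV, mult = (*), one = 1\<rparr>"


section \<open>The binary rooted tree and its automorphisms\<close>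

datatype letter = La | Lb

type_synonym word = "letter list"

abbreviation T_inf :: "word set" where
  "T_inf \<equiv> UNIV"

definition T_level :: "nat \<Rightarrow> word set" where
  "T_level n = {w. length w \<le> n}"

definition adj :: "word \<Rightarrow> word \<Rightarrow> bool" where
  "adj u v \<longleftrightarrow> (\<exists>s. v = u @ [s] \<or> u = v @ [s])"

text \<open>\<open>tree_aut V\<close> is the group, under composition, of the root-preserving automorphisms of
  the subtree with node set \<open>V\<close>. As in \<^const>\<open>BijGroup\<close>, its elements are extensional:
  they take the value \<open>undefined\<close> outside \<open>V\<close>.\<close>

definition tree_aut :: "word set \<Rightarrow> (word \<Rightarrow> word) monoid" where
  "tree_aut V = (BijGroup V)\<lparr>carrier :=
     {\<sigma> \<in> Bij V. \<sigma> [] = [] \<and> (\<forall>u\<in>V. \<forall>v\<in>V. adj (\<sigma> u) (\<sigma> v) \<longleftrightarrow> adj u v)}\<rparr>"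

definition level_fixer :: "nat \<Rightarrow> (word \<Rightarrow> word) set" where
  "level_fixer m = {\<sigma> \<in> carrier (tree_aut T_inf). \<forall>w. length w \<le> m \<longrightarrow> \<sigma> w = w}"

definition aut_topology :: "(word \<Rightarrow> word) topology" where
  "aut_topology = topology_generated_by
     {\<sigma> <#\<^bsub>tree_aut T_inf\<^esub> level_fixer m | \<sigma> m. \<sigma> \<in> carrier (tree_aut T_inf)}"


section \<open>The maps \<open>Par\<close>, \<open>Q\<close> and \<open>P\<close>\<close>

text \<open>An automorphism either preserves or exchanges the two children, so the \<open>else\<close> case is
  exactly \<open>\<sigma> (xa) = \<sigma> (x) b\<close> and \<open>\<sigma> (xb) = \<sigma> (x) a\<close>.\<close>

definition Par :: "(word \<Rightarrow> word) \<Rightarrow> word \<Rightarrow> nat" where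
  "Par \<sigma> x = (if \<sigma> (x @ [La]) = \<sigma> x @ [La] \<and> \<sigma> (x @ [Lb]) = \<sigma> x @ [Lb] then 0 else 1)"

definition interleave_a :: "letter list \<Rightarrow> word" where
  "interleave_a s = concat (map (\<lambda>t. [La, t]) s)"

definition Q_map :: "(word \<Rightarrow> word) \<Rightarrow> word \<Rightarrow> z2adic" where
  "Q_map \<sigma> x = (\<Sum>i. 2 ^ i * of_nat (\<Sum>s | length s = i. Par \<sigma> (x @ interleave_a s)))"

definition P_map :: "(word \<Rightarrow> word) \<Rightarrow> word \<Rightarrow> z2adic" where
  "P_map \<sigma> x = (-1) ^ Par \<sigma> x
     + 2 * (\<Sum>t\<in>{La, Lb}. Q_map \<sigma> (x @ [Lb, t])) - 2 * (\<Sum>t\<in>{La, Lb}. Q_map \<sigma> (x @ [La, t]))"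

text \<open>Only used for \<open>length x \<le> n\<close>, where the subtraction is genuine.\<close>

definition prec :: "nat \<Rightarrow> word \<Rightarrow> nat" where
  "prec n x = (n - length x + 1) div 2"

text \<open>For \<open>\<tau> \<in> Aut(T\<^sub>n)\<close> and \<open>x\<close> a node of \<open>T\<^sub>n\<close>: the common value, as a reduced residue
  modulo \<open>2 ^ prec n x\<close>, of \<open>P_map \<sigma> x\<close> over all extensions \<open>\<sigma>\<close> of \<open>\<tau>\<close>.\<close>

definition P_fin :: "nat \<Rightarrow> (word \<Rightarrow> word) \<Rightarrow> word \<Rightarrow> int" where
  "P_fin n \<tau> x = (THE r. \<forall>\<sigma>\<in>carrier (tree_aut T_inf).
     restrict \<sigma> (T_level n) = \<tau> \<longrightarrow> z2_res (P_map \<sigma> x) (prec n x) = r)"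

definition M_inf :: "(word \<Rightarrow> word) monoid" where
  "M_inf = (tree_aut T_inf)\<lparr>carrier := {\<sigma> \<in> carrier (tree_aut T_inf). \<forall>x. P_map \<sigma> x = P_map \<sigma> []}\<rparr>"

definition M_fin :: "nat \<Rightarrow> (word \<Rightarrow> word) monoid" where
  "M_fin n = (tree_aut (T_level n))\<lparr>carrier :=
     {\<tau> \<in> carrier (tree_aut (T_level n)).
       \<forall>x\<in>T_level n. [P_fin n \<tau> x = P_fin n \<tau> []] (mod 2 ^ prec n x)}\<rparr>"


section \<open>The Basilica group\<close>

definition aut_of_Par :: "(word \<Rightarrow> nat) \<Rightarrow> word \<Rightarrow> word" where
  "aut_of_Par p = (THE \<sigma>. \<sigma> \<in> carrier (tree_aut T_inf) \<and> (\<forall>x. Par \<sigma> x = p x))"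

definition basilica_alpha :: "word \<Rightarrow> word" where
  "basilica_alpha = aut_of_Par (\<lambda>x. if \<exists>k. even k \<and> x = replicate k Lb then 1 else 0)"

definition basilica_beta :: "word \<Rightarrow> word" where
  "basilica_beta = aut_of_Par (\<lambda>x. if \<exists>k. odd k \<and> x = replicate k Lb then 1 else 0)"

definition basilica :: "(word \<Rightarrow> word) set" where
  "basilica = generate (tree_aut T_inf) {basilica_alpha, basilica_beta}"

definition B_inf_closure :: "(word \<Rightarrow> word) monoid" where
  "B_inf_closure = (tree_aut T_inf)\<lparr>carrier := Abstract_Topology.closure_of aut_topology basilica\<rparr>"

definition B_fin :: "nat \<Rightarrow> (word \<Rightarrow> word) monoid" where
  "B_fin n = (tree_aut (T_level n))\<lparr>carrier := (\<lambda>\<sigma>. restrict \<sigma> (T_level n)) ` basilica\<rparr>"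


section \<open>Short exact sequences\<close>

text \<open>The library's \<open>short_exact_sequence\<close> requires all groups to have the same element type;
  this is its unfolded form (\<open>short_exact_sequence_iff\<close>) for arbitrary types. It states
  exactness of \<open>0 \<rightarrow> A \<rightarrow> B \<rightarrow> C \<rightarrow> 0\<close> with maps \<open>f\<close> and \<open>g\<close>.\<close>

definition short_exact ::
  "'a monoid \<Rightarrow> ('a \<Rightarrow> 'b) \<Rightarrow> 'b monoid \<Rightarrow> ('b \<Rightarrow> 'c) \<Rightarrow> 'c monoid \<Rightarrow> bool" where
  "short_exact A f B g C \<longleftrightarrow>
     group A \<and> group B \<and> group C \<and> f \<in> mon A B \<and> g \<in> epi B C
     \<and> f ` carrier A = kernel B C g"

end

theory Submission
  imports Defs
begin

text \<open>An automorphism is determined by its portrait, the set of nodes at which it exchanges the two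
  children, and for a portrait \<open>p\<close> with sections \<open>p\<^sub>a\<close>, \<open>p\<^sub>b\<close> at the children of the root the
  series defining \<open>Q\<close> and \<open>P\<close> become recursions. With \<open>Q\<^sub>1(p) = Q(p\<^sub>a) + Q(p\<^sub>b)\<close>,
  \<open>Q(p) = Par(p) + 2 Q\<^sub>1(p\<^sub>a)\<close> and \<open>P(p) = \<plusminus>1 + 2 (Q\<^sub>1(p\<^sub>b) - Q\<^sub>1(p\<^sub>a))\<close>.
  If \<open>P\<close> takes the constant value \<open>P(p)\<close> on all sections of \<open>p\<close>, then \<open>Q(pq) = Q(p) + P(p) Q(q)\<close>
  and hence \<open>P(pq) = P(p) P(q)\<close>.

  On \<open>P = 1\<close> the maps \<open>Q\<close> and \<open>Q\<^sub>1\<close> are therefore homomorphisms; they count the occurrences of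
  \<open>\<alpha>\<close> and \<open>\<beta>\<close>. A pair of sections \<open>(g, h)\<close> of elements of the Basilica group comes from
  that group as soon as \<open>g\<close> and \<open>h\<close> have the same \<open>\<beta>\<close>-exponent, and \<open>P = 1\<close> says
  exactly that \<open>Q\<^sub>1\<close> agrees on the two sections (after division by \<open>\<alpha>\<close>). By induction on the level
  every portrait with \<open>P = 1\<close> is approximated by the Basilica group. Conversely \<open>P(p) = u\<close> only
  prescribes \<open>Q\<^sub>1(p\<^sub>b) - Q\<^sub>1(p\<^sub>a)\<close>, so portraits with any odd \<open>P\<close> and any \<open>Q\<close>, \<open>Q\<^sub>1\<close> can be
  constructed from the root downwards, and at finite level counted by the values of \<open>Q\<close>, \<open>Q\<^sub>1\<close>.\<close>

section \<open>Residues in the ring of 2-adic integers\<close>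

lemma z2_res_0 [simp]: "z2_res x 0 = 0"
  using z2_res_mod[of x 0] by simp

lemma z2_res_of_int: "z2_res (of_int n) k = n mod 2 ^ k"
proof (cases n)
  case (nonneg m)
  then show ?thesis by (simp add: z2_res_of_nat)
next
  case (neg m)
  have "z2_res (of_int n) k = z2_res (- of_nat (Suc m)) k"
    using neg by simp
  also have "\<dots> = (- int (Suc m)) mod 2 ^ k"
    by (simp only: z2_res_uminus z2_res_of_nat mod_minus_eq)
  finally show ?thesis using neg by simp
qed

lemma z2_res_double: "z2_res (2 * x) (Suc k) = 2 * z2_res x k"
proof -
  have "z2_res (2 * x) (Suc k) = (z2_res 2 (Suc k) * z2_res x (Suc k)) mod 2 ^ Suc k"
    by (rule z2_res_mult)
  also have "z2_res 2 (Suc k) = 2 mod 2 ^ Suc k"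
    using z2_res_of_nat[of 2 "Suc k"] by simp
  also have "(2 mod 2 ^ Suc k * z2_res x (Suc k)) mod 2 ^ Suc k = (2 * z2_res x (Suc k)) mod (2 * 2 ^ k)"
    by (simp only: mod_mult_left_eq power_Suc)
  also have "\<dots> = 2 * z2_res x k"
    by (simp only: mult_mod_right[symmetric] z2_res_Suc)
  finally show ?thesis .
qed

text \<open>Half of the residue of \<open>x\<close> modulo \<open>2 ^ (k + 1)\<close> is well
  defined modulo \<open>2 ^ k\<close>, and these halves form a compatible family.\<close>

lemma z2_even_imp_double:
  assumes "z2_res x 1 = 0"
  shows "\<exists>y. x = 2 * y"
proof -
  define g where "g k = z2_res x (Suc k) div 2" for k
  have ev: "even (z2_res x (Suc k))" for k
    using z2_res_le[of 1 "Suc k" x] assms by (simp add: even_iff_mod_2_eq_zero)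
  have dbl: "2 * g k = z2_res x (Suc k)" for k
    using ev[of k] by (simp add: g_def)
  have comp: "g (Suc k) mod 2 ^ k = g k mod 2 ^ k" for k
  proof -
    have "2 * (g (Suc k) mod 2 ^ k) = z2_res x (Suc (Suc k)) mod 2 ^ Suc k"
      by (simp only: mult_mod_right dbl power_Suc)
    also have "\<dots> = z2_res x (Suc k) mod 2 ^ Suc k"
      by (simp only: z2_res_Suc z2_res_mod)
    also have "\<dots> = 2 * (g k mod 2 ^ k)"
      by (simp only: mult_mod_right dbl power_Suc)
    finally show ?thesis by simp
  qed
  define y where "y = Abs_z2adic (\<lambda>k. g k mod 2 ^ k)"
  have "z2_res x k = z2_res (2 * y) k" for k
  proof (cases k)
    case (Suc m)
    have "z2_res (2 * y) k = 2 * (g m mod 2 ^ m)"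
      unfolding Suc z2_res_double y_def by (subst z2_res_Abs[OF comp]) rule
    also have "\<dots> = z2_res x k"
      by (simp only: mult_mod_right dbl Suc power_Suc[symmetric] z2_res_mod)
    finally show ?thesis by simp
  qed simp
  then show ?thesis using z2adic_eqI by blast
qed

lemma z2_res_eq_0_iff: "z2_res x k = 0 \<longleftrightarrow> 2 ^ k dvd x"
proof
  show "2 ^ k dvd x" if "z2_res x k = 0"
    using that
  proof (induction k arbitrary: x)
    case (Suc k)
    have "z2_res x 1 = 0"
      using z2_res_le[of 1 "Suc k" x] Suc.prems by simp
    then obtain y where y: "x = 2 * y" using z2_even_imp_double by blast
    with Suc.prems have "z2_res y k = 0" by (simp add: z2_res_double)
    with Suc.IH have "2 ^ k dvd y" by blast
    then show ?case unfolding y power_Suc by (intro mult_dvd_mono) auto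
  qed simp
  show "z2_res x k = 0" if "2 ^ k dvd x"
    using that z2_res_pow2_mult by auto
qed

lemma z2_res_eq_iff: "z2_res x k = z2_res y k \<longleftrightarrow> 2 ^ k dvd x - y"
proof -
  have "z2_res (x - y) k = 0 \<longleftrightarrow> (2 ^ k dvd z2_res x k - z2_res y k)"
    by (simp add: z2_res_diff dvd_eq_mod_eq_0)
  also have "\<dots> \<longleftrightarrow> z2_res x k mod 2 ^ k = z2_res y k mod 2 ^ k"
    by (simp only: mod_eq_dvd_iff)
  finally show ?thesis by (simp only: z2_res_eq_0_iff z2_res_mod)
qed

text \<open>This replaces limit arguments: identities between 2-adic series are proved modulo
  \<open>2 ^ k\<close> by induction on \<open>k\<close>.\<close>

lemma z2_eqI: "(\<And>k. 2 ^ k dvd x - y) \<Longrightarrow> x = (y :: z2adic)"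
  by (rule z2adic_eqI) (simp add: z2_res_eq_iff)

lemma pow2_dvd_of_int_z2: "(2 ^ k :: z2adic) dvd of_int n \<longleftrightarrow> 2 ^ k dvd n"
  by (simp only: z2_res_eq_0_iff[symmetric] z2_res_of_int dvd_eq_mod_eq_0)

lemma pow2_Suc_dvd_double: "(2 ^ Suc k :: z2adic) dvd 2 * x \<longleftrightarrow> 2 ^ k dvd x"
  by (simp only: z2_res_eq_0_iff[symmetric] z2_res_double) simp

lemma z2_odd_cases: "z2_res x 1 = 0 \<or> z2_res x 1 = 1"
proof -
  have "z2_res x 1 mod 2 ^ 1 = z2_res x 1" by (rule z2_res_mod)
  moreover have "0 \<le> z2_res x 1 mod 2 \<and> z2_res x 1 mod 2 < 2" by simp
  ultimately show ?thesis unfolding power_one_right by linarith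
qed

lemma z2_unit_odd:
  assumes "x * y = (1 :: z2adic)"
  shows "z2_res x 1 = 1"
proof (rule ccontr)
  assume "z2_res x 1 \<noteq> 1"
  then have "z2_res (x * y) 1 = 0"
    using z2_odd_cases[of x] by (simp add: z2_res_mult)
  then show False using assms by (simp add: z2_res_one)
qed

lemma carrier_z2_units: "x \<in> carrier z2_units \<longleftrightarrow> (\<exists>y. x * y = 1)"
  by (auto simp: z2_units_def units_of_def Units_def mult.commute)

lemma group_z2_units: "group z2_units"
proof -
  interpret monoid "\<lparr>carrier = UNIV, mult = (*), one = 1\<rparr> :: z2adic monoid"
    by unfold_locales (auto simp: mult.assoc)
  show ?thesis unfolding z2_units_def by (rule units_group)
qed

section \<open>Portraits of tree automorphisms\<close>

type_synonym portrait = "word \<Rightarrow> bool"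

definition sect :: "portrait \<Rightarrow> word \<Rightarrow> portrait" where
  "sect p x = (\<lambda>y. p (x @ y))"

lemma sect_apply: "sect p x y = p (x @ y)"
  by (simp add: sect_def)

lemma sect_root [simp]: "sect p x [] = p x"
  by (simp add: sect_def)

lemma sect_sect [simp]: "sect (sect p x) y = sect p (x @ y)"
  by (simp add: sect_def)

lemma sect_Nil [simp]: "sect p [] = p"
  by (simp add: sect_def)

fun swap_letter :: "letter \<Rightarrow> letter" where
  "swap_letter La = Lb"
| "swap_letter Lb = La"

lemma swap_letter_simps [simp]: "swap_letter (swap_letter s) = s" "swap_letter s \<noteq> s"
  by (cases s; simp)+

lemma UNIV_letter: "(UNIV :: letter set) = {La, Lb}"
  using letter.exhaust by blast

definition act_letter :: "bool \<Rightarrow> letter \<Rightarrow> letter" where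
  "act_letter e s = (if e then swap_letter s else s)"

lemma act_letter_inject [simp]: "act_letter e s = act_letter e t \<longleftrightarrow> s = t"
  by (cases s; cases t) (auto simp: act_letter_def)

lemma act_letter_act_letter: "act_letter e (act_letter f s) = act_letter (f \<noteq> e) s"
  by (auto simp: act_letter_def)

text \<open>The portrait is evaluated at prefixes of the argument, not of its image, in accordance
  with \<open>Par\<close>, which is indexed by the source node.\<close>

fun act :: "portrait \<Rightarrow> word \<Rightarrow> word" where
  "act p [] = []"
| "act p (s # w) = act_letter (p []) s # act (sect p [s]) w"

lemma act_append: "act p (x @ y) = act p x @ act (sect p x) y"
  by (induction x arbitrary: p) auto

lemma act_snoc: "act p (x @ [s]) = act p x @ [act_letter (p x) s]"
  by (simp add: act_append)

lemma length_act [simp]: "length (act p x) = length x"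
  by (induction x arbitrary: p) auto

lemma act_inject [simp]: "act p x = act p y \<longleftrightarrow> x = y"
proof (induction x arbitrary: p y)
  case Nil
  then show ?case by (cases y) auto
next
  case (Cons s x)
  then show ?case by (cases y) auto
qed

lemma ex_act_eq: "\<exists>x. act p x = y"
proof (induction y arbitrary: p)
  case Nil
  have "act p [] = []" by simp
  then show ?case ..
next
  case (Cons t y)
  let ?s = "act_letter (p []) t"
  obtain x where "act (sect p [?s]) x = y" using Cons.IH by blast
  then have "act p (?s # x) = t # y"
    by (simp add: act_letter_act_letter) (simp add: act_letter_def)
  then show ?case by blast
qed

lemma Par_act: "Par (act p) x = of_bool (p x)"
  by (simp add: Par_def act_snoc act_letter_def)

lemma act_eq_iff: "act p = act q \<longleftrightarrow> p = q"
proof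
  assume "act p = act q"
  then have "(of_bool (p x) :: nat) = of_bool (q x)" for x by (simp only: Par_act[symmetric])
  then show "p = q" by (intro ext) (metis of_bool_eq_iff)
qed simp

text \<open>Portrait of \<open>act p\<close> after \<open>act q\<close>: parities add modulo 2, that
  of \<open>p\<close> being read at the image node.\<close>

definition mul :: "portrait \<Rightarrow> portrait \<Rightarrow> portrait" where
  "mul p q = (\<lambda>x. q x \<noteq> p (act q x))"

lemma act_mul: "act (mul p q) x = act p (act q x)"
  by (induction x rule: rev_induct) (simp_all add: act_snoc mul_def act_letter_act_letter)

lemma mul_assoc: "mul (mul p q) r = mul p (mul q r)"
proof
  fix x
  have "mul p (mul q r) x = (mul q r x \<noteq> p (act q (act r x)))"
    by (simp only: mul_def[of p] act_mul)
  then show "mul (mul p q) r x = mul p (mul q r) x"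
    by (auto simp: mul_def)
qed

lemma sect_mul: "sect (mul p q) x = mul (sect p (act q x)) (sect q x)"
  by (rule ext) (simp add: mul_def sect_apply act_append)

text \<open>Portraits are total functions without side conditions, so the group computations are
  done here; \<open>aut_on\<close> carries them to the automorphism groups of the infinite and the
  finite trees alike.\<close>

definition portrait_group :: "portrait monoid" where
  "portrait_group = \<lparr>carrier = UNIV, mult = mul, one = \<lambda>_. False\<rparr>"

lemma portrait_group_simps [simp]:
  "carrier portrait_group = UNIV"
  "mult portrait_group = mul"
  "one portrait_group = (\<lambda>_. False)"
  by (simp_all add: portrait_group_def)

lemma act_one [simp]: "act (\<lambda>_. False) x = x"
  by (induction x rule: rev_induct) (simp_all add: act_snoc act_letter_def)

interpretation PG: group portrait_group
proof (rule groupI)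
  fix p q r
  show "p \<otimes>\<^bsub>portrait_group\<^esub> q \<otimes>\<^bsub>portrait_group\<^esub> r = p \<otimes>\<^bsub>portrait_group\<^esub> (q \<otimes>\<^bsub>portrait_group\<^esub> r)"
    by (simp add: mul_assoc)
  show "\<one>\<^bsub>portrait_group\<^esub> \<otimes>\<^bsub>portrait_group\<^esub> p = p"
    by (simp add: mul_def)
  have "mul (\<lambda>y. p (inv_into UNIV (act p) y)) p = (\<lambda>_. False)"
    by (simp add: mul_def inv_f_f inj_def)
  then show "\<exists>q\<in>carrier portrait_group. q \<otimes>\<^bsub>portrait_group\<^esub> p = \<one>\<^bsub>portrait_group\<^esub>"
    by auto
qed auto

section \<open>Automorphism groups of the infinite and the finite trees\<close>

definition full_subtree :: "word set \<Rightarrow> bool" where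
  "full_subtree V \<longleftrightarrow> [] \<in> V \<and> (\<forall>x s. x @ [s] \<in> V \<longrightarrow> x \<in> V)
     \<and> (\<forall>x y. length x = length y \<longrightarrow> x \<in> V \<longrightarrow> y \<in> V)"

lemma full_subtree_UNIV [simp]: "full_subtree UNIV"
  by (simp add: full_subtree_def)

lemma full_subtree_T_level [simp]: "full_subtree (T_level n)"
  by (simp add: full_subtree_def T_level_def)

definition aut_on :: "word set \<Rightarrow> portrait \<Rightarrow> word \<Rightarrow> word" where
  "aut_on V p = restrict (act p) V"

lemma aut_on_UNIV [simp]: "aut_on UNIV p = act p"
  by (rule ext) (simp add: aut_on_def)

lemma act_in_full_subtree: "full_subtree V \<Longrightarrow> act p x \<in> V \<longleftrightarrow> x \<in> V"
  unfolding full_subtree_def by (metis length_act)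

lemma aut_on_Bij:
  assumes "full_subtree V"
  shows "aut_on V p \<in> Bij V"
proof -
  have "bij_betw (act p) V V"
    unfolding bij_betw_def
  proof
    show "inj_on (act p) V" by (simp add: inj_on_def)
    show "act p ` V = V"
      using act_in_full_subtree[OF assms] ex_act_eq[of p] by (metis (mono_tags, opaque_lifting) imageI image_subset_iff subsetI subset_antisym)
  qed
  then show ?thesis
    by (simp add: Bij_def aut_on_def cong: bij_betw_cong)
qed

lemma adj_act: "adj (act p u) (act p v) \<longleftrightarrow> adj u v"
proof -
  have "(\<exists>s. act p v = act p u @ [s]) \<longleftrightarrow> (\<exists>s. v = u @ [s])" for u v
  proof
    assume "\<exists>s. act p v = act p u @ [s]"
    then obtain s where "act p v = act p u @ [s]" ..
    also have "\<dots> = act p (u @ [act_letter (p u) s])"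
      by (simp add: act_snoc act_letter_act_letter) (simp add: act_letter_def)
    finally show "\<exists>s. v = u @ [s]" by auto
  qed (auto simp: act_snoc)
  then show ?thesis unfolding adj_def by blast
qed

text \<open>Induction on the length of the word: fixing the root and preserving adjacency forces
  children to go to children, and injectivity leaves only the two assignments of letters.\<close>

lemma tree_aut_eq_aut_on:
  assumes V: "full_subtree V" and \<sigma>: "\<sigma> \<in> carrier (tree_aut V)"
  shows "\<exists>p. \<sigma> = aut_on V p"
proof -
  from \<sigma> have ext: "\<sigma> \<in> extensional V" and inj: "inj_on \<sigma> V" and root: "\<sigma> [] = []"
    and adj: "\<And>u v. u \<in> V \<Longrightarrow> v \<in> V \<Longrightarrow> adj (\<sigma> u) (\<sigma> v) \<longleftrightarrow> adj u v"
    by (auto simp: tree_aut_def Bij_def bij_betw_def)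
  have prefix: "x @ [s] \<in> V \<Longrightarrow> x \<in> V" and same: "x @ [s] \<in> V \<Longrightarrow> x @ [t] \<in> V" for x s t
    using V unfolding full_subtree_def by (blast, metis length_append_singleton)
  define p where "p x \<longleftrightarrow> \<sigma> (x @ [La]) = \<sigma> x @ [Lb]" for x
  have "x \<in> V \<longrightarrow> \<sigma> x = act p x" for x
  proof (induction x rule: length_induct)
    case (1 x)
    show ?case
    proof (cases x rule: rev_cases)
      case Nil
      with root show ?thesis by simp
    next
      case (snoc w s)
      show ?thesis
      proof
        assume x: "x \<in> V"
        then have w: "w \<in> V" and wt: "w @ [t] \<in> V" for t
          using snoc prefix same by blast+
        have IH: "\<sigma> y = act p y" if "y \<in> V" "length y \<le> length w" for y
          using 1 snoc that by simp
        \<comment> \<open>The neighbours of \<open>\<sigma> w\<close> are its children and its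
          parent; the parent is already the image of the parent of \<open>w\<close>, or does not
          exist if \<open>w\<close> is the root.\<close>
        have "\<exists>r. \<sigma> (w @ [t]) = \<sigma> w @ [r]" for t
        proof (rule ccontr)
          assume no: "\<nexists>r. \<sigma> (w @ [t]) = \<sigma> w @ [r]"
          have "adj (\<sigma> w) (\<sigma> (w @ [t]))"
            using adj[OF w wt] by (auto simp: adj_def)
          with no obtain r where r: "\<sigma> w = \<sigma> (w @ [t]) @ [r]" by (auto simp: adj_def)
          show False
          proof (cases w rule: rev_cases)
            case Nil
            with r root show False by simp
          next
            case (snoc y u)
            with w have y: "y \<in> V" using prefix by blast
            have "\<sigma> w = \<sigma> y @ [act_letter (p y) u]"
              using IH[OF w] IH[OF y] snoc by (simp add: act_snoc)
            with r have "\<sigma> y = \<sigma> (w @ [t])" by simp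
            then have "y = w @ [t]" using inj y wt by (auto dest: inj_onD)
            with snoc show False by simp
          qed
        qed
        then obtain r where r: "\<And>t. \<sigma> (w @ [t]) = \<sigma> w @ [r t]" by metis
        have "w @ [La] = w @ [Lb]" if "r La = r Lb"
          using inj_onD[OF inj _ wt wt, of La Lb] r that by simp
        then have "r La \<noteq> r Lb" by auto
        then have "r s = act_letter (p w) s"
          by (cases s; cases "r La"; cases "r Lb") (auto simp: p_def r act_letter_def)
        then show "\<sigma> x = act p x"
          using snoc r IH[OF w] by (simp add: act_snoc)
      qed
    qed
  qed
  then have "\<sigma> = aut_on V p"
    unfolding aut_on_def by (intro extensionalityI[OF ext restrict_extensional]) simp
  then show ?thesis by blast
qed

lemma carrier_tree_aut:
  assumes V: "full_subtree V"
  shows "carrier (tree_aut V) = range (aut_on V)"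
proof
  show "carrier (tree_aut V) \<subseteq> range (aut_on V)"
    using tree_aut_eq_aut_on[OF V] by blast
  have "[] \<in> V" using V by (simp add: full_subtree_def)
  then show "range (aut_on V) \<subseteq> carrier (tree_aut V)"
    using aut_on_Bij[OF V] by (auto simp: tree_aut_def) (simp_all add: aut_on_def adj_act)
qed

lemma aut_on_mul:
  assumes V: "full_subtree V"
  shows "mult (tree_aut V) (aut_on V p) (aut_on V q) = aut_on V (mul p q)"
proof -
  have "compose V (aut_on V p) (aut_on V q) = aut_on V (mul p q)"
    unfolding aut_on_def compose_def
    by (rule restrict_ext) (simp add: act_in_full_subtree[OF V] act_mul)
  then show ?thesis
    using aut_on_Bij[OF V] by (simp add: tree_aut_def BijGroup_def)
qed

lemma aut_on_hom: "full_subtree V \<Longrightarrow> aut_on V \<in> hom portrait_group (tree_aut V)"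
  by (auto simp: hom_def carrier_tree_aut aut_on_mul)

text \<open>\<open>aut_on V\<close> is a homomorphism into the group of all bijections of
  \<open>V\<close>, so images of subgroups are subgroups there. The four groups of automorphisms in
  the theorem are obtained in this way.\<close>

lemma group_tree_aut_image:
  assumes V: "full_subtree V" and H: "subgroup H portrait_group"
  shows "group (tree_aut V\<lparr>carrier := aut_on V ` H\<rparr>)"
proof -
  have "aut_on V \<in> hom portrait_group (BijGroup V)"
    using aut_on_Bij[OF V] aut_on_mul[OF V] by (auto simp: hom_def BijGroup_def tree_aut_def)
  then interpret group_hom portrait_group "BijGroup V" "aut_on V"
    by (intro group_hom.intro PG.is_group group_BijGroup group_hom_axioms.intro)
  have "group (BijGroup V\<lparr>carrier := aut_on V ` H\<rparr>)"
    by (intro H.subgroup_imp_group subgroup_img_is_subgroup H)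
  then show ?thesis by (simp add: tree_aut_def)
qed

lemma group_tree_aut: "full_subtree V \<Longrightarrow> group (tree_aut V)"
  using group_tree_aut_image[OF _ PG.subgroup_self, of V] by (simp add: carrier_tree_aut[symmetric])

section \<open>Agreement of portraits on the first levels\<close>

definition agree :: "nat \<Rightarrow> portrait \<Rightarrow> portrait \<Rightarrow> bool" where
  "agree n p q \<longleftrightarrow> (\<forall>x. length x < n \<longrightarrow> p x = q x)"

lemma agree_act:
  assumes "agree n p q" "length x \<le> n"
  shows "act p x = act q x"
  using assms(2)
proof (induction x rule: rev_induct)
  case (snoc s x)
  then show ?case using assms(1) by (simp add: act_snoc agree_def)
qed simp

text \<open>The parity at a node acts one level below it, hence the strict bound in
  \<open>agree\<close> for words of length up to \<open>n\<close>.\<close>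

lemma aut_on_T_level_eq_iff:
  "aut_on (T_level n) p = aut_on (T_level n) q \<longleftrightarrow> agree n p q"
proof
  assume eq: "aut_on (T_level n) p = aut_on (T_level n) q"
  have act: "act p x = act q x" if "length x \<le> n" for x
    using fun_cong[OF eq, of x] that by (simp add: aut_on_def T_level_def)
  show "agree n p q"
    unfolding agree_def
  proof (intro allI impI)
    fix x :: word assume "length x < n"
    then have "act_letter (p x) La = act_letter (q x) La"
      using act[of "x @ [La]"] by (simp add: act_snoc)
    then show "p x = q x" by (auto simp: act_letter_def split: if_splits)
  qed
next
  assume "agree n p q"
  then show "aut_on (T_level n) p = aut_on (T_level n) q"
    unfolding aut_on_def by (intro restrict_ext) (simp add: agree_act T_level_def)
qed

lemma agree_refl [simp]: "agree n p p"
  by (simp add: agree_def)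

lemma agree_sym: "agree n p q \<Longrightarrow> agree n q p"
  by (simp add: agree_def)

lemma agree_trans [trans]: "agree n p q \<Longrightarrow> agree n q r \<Longrightarrow> agree n p r"
  by (simp add: agree_def)

lemma agree_mono: "agree n p q \<Longrightarrow> m \<le> n \<Longrightarrow> agree m p q"
  by (simp add: agree_def)

lemma agree_mul: "agree n p p' \<Longrightarrow> agree n q q' \<Longrightarrow> agree n (mul p q) (mul p' q')"
  using agree_act[of n q q'] by (simp add: agree_def mul_def)

lemma agree_sect: "agree n p q \<Longrightarrow> agree (n - length x) (sect p x) (sect q x)"
  by (auto simp: agree_def sect_apply)

section \<open>The cocycle identities for Q and P\<close>

lemma z2_res_suminf_pow2:
  "z2_res (\<Sum>i. 2 ^ i * c i) k = z2_res (\<Sum>i<k. 2 ^ i * c i :: z2adic) k"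
proof -
  let ?S = "\<lambda>n. \<Sum>i<n. 2 ^ i * c i :: z2adic"
  have "z2_res (?S (Suc m)) m = z2_res (?S m) m" for m
    unfolding z2_res_eq_iff by simp
  then have "z2_res (Abs_z2adic (\<lambda>k. z2_res (?S k) k)) = (\<lambda>k. z2_res (?S k) k)"
    by (intro Abs_z2adic_inverse) (simp del: sum.lessThan_Suc add: z2_res_Suc)
  then show ?thesis
    by (simp only: sums_unique[OF z2_pow_sums, symmetric])
qed

lemma mul_Nil [simp]: "mul p q [] \<longleftrightarrow> q [] \<noteq> p []"
  by (simp add: mul_def)

lemma sum_lists_Suc:
  "(\<Sum>s | length s = Suc i. f s) = (\<Sum>s | length s = i. f (La # s)) + (\<Sum>s | length s = i. f (Lb # s))"
  for f :: "letter list \<Rightarrow> nat"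
proof -
  have "finite (UNIV :: letter set)" by (simp add: UNIV_letter)
  then have fin: "finite {s :: letter list. length s = i}"
    using finite_lists_length_eq[of "UNIV :: letter set" i] by simp
  have *: "{s. length s = Suc i} = (#) La ` {s. length s = i} \<union> (#) Lb ` {s. length s = i}"
    (is "?L = ?R")
  proof
    show "?L \<subseteq> ?R"
    proof
      fix s :: "letter list" assume "s \<in> ?L"
      then obtain t w where "s = t # w" "length w = i" by (auto simp: length_Suc_conv)
      then show "s \<in> ?R" by (cases t) auto
    qed
  qed auto
  then show ?thesis
    using fin unfolding * by (subst sum.union_disjoint) (auto simp: sum.reindex inj_on_def)
qed

text \<open>The term \<open>i = 0\<close> is split off and the remaining words are sorted by their
  first letter. This is exact for truncated series, where one unfolding lowers the number of terms
  by one.\<close>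

lemma Q_map_rec:
  "Q_map \<sigma> x = of_nat (Par \<sigma> x) + 2 * (Q_map \<sigma> (x @ [La, La]) + Q_map \<sigma> (x @ [La, Lb]))"
proof (rule z2adic_eqI)
  fix k
  define N where "N i x = (\<Sum>s | length s = i. Par \<sigma> (x @ interleave_a s))" for i x
  have N_0: "N 0 x = Par \<sigma> x" for x
    by (simp add: N_def interleave_a_def)
  have N_Suc: "N (Suc i) x = N i (x @ [La, La]) + N i (x @ [La, Lb])" for i x
    by (simp add: N_def sum_lists_Suc interleave_a_def)
  define S where "S k x = (\<Sum>i<k. 2 ^ i * of_nat (N i x) :: z2adic)" for k x
  have S_Suc: "S (Suc m) x = of_nat (Par \<sigma> x) + 2 * (S m (x @ [La, La]) + S m (x @ [La, Lb]))" for m x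
    unfolding S_def sum.lessThan_Suc_shift
    by (simp add: N_0 N_Suc distrib_left sum.distrib sum_distrib_left mult.assoc)
  have Q: "2 ^ k dvd Q_map \<sigma> x - S k x" for k x
    unfolding z2_res_eq_iff[symmetric] Q_map_def z2_res_suminf_pow2 by (simp only: S_def N_def)
  show "z2_res (Q_map \<sigma> x) k
     = z2_res (of_nat (Par \<sigma> x) + 2 * (Q_map \<sigma> (x @ [La, La]) + Q_map \<sigma> (x @ [La, Lb]))) k"
  proof (cases k)
    case (Suc m)
    have "2 ^ m dvd (Q_map \<sigma> (x @ [La, La]) - S m (x @ [La, La])) + (Q_map \<sigma> (x @ [La, Lb]) - S m (x @ [La, Lb]))"
      by (intro dvd_add Q)
    then have "2 ^ Suc m dvd 2 * ((Q_map \<sigma> (x @ [La, La]) - S m (x @ [La, La])) + (Q_map \<sigma> (x @ [La, Lb]) - S m (x @ [La, Lb])))"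
      by (simp only: pow2_Suc_dvd_double)
    from dvd_diff[OF Q[of k x, unfolded Suc S_Suc] this]
    show ?thesis unfolding z2_res_eq_iff Suc by (simp add: algebra_simps)
  qed simp
qed

section \<open>The recursions for Q and P on portraits\<close>

definition Q0 :: "portrait \<Rightarrow> z2adic" where
  "Q0 p = Q_map (act p) []"

definition Q1 :: "portrait \<Rightarrow> z2adic" where
  "Q1 p = Q0 (sect p [La]) + Q0 (sect p [Lb])"

definition P0 :: "portrait \<Rightarrow> z2adic" where
  "P0 p = P_map (act p) []"

lemma Q_map_act: "Q_map (act p) x = Q0 (sect p x)"
  by (simp add: Q0_def Q_map_def Par_act sect_apply)

lemma P_map_act: "P_map (act p) x = P0 (sect p x)"
  by (simp add: P0_def P_map_def Par_act Q_map_act)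

lemma Q0_rec: "Q0 p = of_bool (p []) + 2 * Q1 (sect p [La])"
  unfolding Q0_def by (subst Q_map_rec) (simp add: Par_act Q_map_act Q1_def)

lemma P0_rec: "P0 p = (if p [] then - 1 else 1) + 2 * (Q1 (sect p [Lb]) - Q1 (sect p [La]))"
  by (simp add: P0_def P_map_def Par_act Q_map_act Q1_def algebra_simps)

lemma sect_False [simp]: "sect (\<lambda>_. False) x = (\<lambda>_. False)"
  by (simp add: sect_def)

lemma Q0_one [simp]: "Q0 (\<lambda>_. False) = 0"
  by (simp add: Q0_def Q_map_def Par_act)

lemma Q1_one [simp]: "Q1 (\<lambda>_. False) = 0"
  by (simp add: Q1_def)

lemma P0_one [simp]: "P0 (\<lambda>_. False) = 1"
  by (simp add: P0_rec)

text \<open>The portraits of the elements of \<open>M_inf\<close>, since \<open>P_map\<close> at a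
  node is \<open>P0\<close> of the section there.\<close>

definition const_P :: "portrait \<Rightarrow> bool" where
  "const_P p \<longleftrightarrow> (\<forall>x. P0 (sect p x) = P0 p)"

lemma const_P_sect: "const_P p \<Longrightarrow> const_P (sect p x)" "const_P p \<Longrightarrow> P0 (sect p x) = P0 p"
  by (simp_all add: const_P_def)

text \<open>The premise is the congruence for \<open>Q0\<close> at the same \<open>k\<close>, so
  that this serves inside the induction for \<open>Q0\<close> and afterwards. At the root
  \<open>q\<close> only permutes the two sections of \<open>p\<close>, which leaves their sum
  unchanged.\<close>

lemma Q1_mul_cong:
  assumes Q0: "\<And>p q. const_P p \<Longrightarrow> 2 ^ k dvd Q0 (mul p q) - (Q0 p + P0 p * Q0 q)"
    and p: "const_P p"
  shows "2 ^ k dvd Q1 (mul p q) - (Q1 p + P0 p * Q1 q)"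
proof -
  let ?s = "act_letter (q [])"
  have "2 ^ k dvd (\<Sum>t\<in>UNIV. Q0 (sect (mul p q) [t]) - (Q0 (sect p [?s t]) + P0 p * Q0 (sect q [t])))"
  proof (rule dvd_sum)
    fix t
    show "2 ^ k dvd Q0 (sect (mul p q) [t]) - (Q0 (sect p [?s t]) + P0 p * Q0 (sect q [t]))"
      using Q0[OF const_P_sect(1)[OF p], of "[?s t]" "sect q [t]"]
      by (simp add: sect_mul const_P_sect(2)[OF p])
  qed
  also have "(\<Sum>t\<in>UNIV. Q0 (sect (mul p q) [t]) - (Q0 (sect p [?s t]) + P0 p * Q0 (sect q [t])))
      = Q1 (mul p q) - (Q1 p + P0 p * Q1 q)"
    by (simp add: UNIV_letter Q1_def act_letter_def algebra_simps)
  finally show ?thesis .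
qed

text \<open>The factor 2 in the recursion for \<open>Q0\<close> gains one power of 2 per step, and
  constancy of P gives all sections of \<open>p\<close> the same multiplier
  \<open>P0 p\<close>.\<close>

lemma Q0_mul_cong:
  "const_P p \<Longrightarrow> 2 ^ k dvd Q0 (mul p q) - (Q0 p + P0 p * Q0 q)"
proof (induction k arbitrary: p q)
  case (Suc k)
  let ?t = "act_letter (q []) La"
  have u: "P0 p = (if p [] then - 1 else 1) + 2 * (Q1 (sect p [Lb]) - Q1 (sect p [La]))"
    by (rule P0_rec)
  have "Q0 (mul p q) - (Q0 p + P0 p * Q0 q)
      = 2 * (Q1 (mul (sect p [?t]) (sect q [La])) - (Q1 (sect p [?t]) + P0 p * Q1 (sect q [La])))"
  proof (cases "q []")
    case False
    then show ?thesis
      by (simp add: Q0_rec sect_mul act_letter_def algebra_simps)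
  next
    \<comment> \<open>If \<open>q\<close> exchanges the children of the root, the product meets the
      section of \<open>p\<close> at \<open>Lb\<close> instead of \<open>La\<close>; the summand
      \<open>P0 p\<close> accounts exactly for this difference.\<close>
    case True
    then have "Q0 p + P0 p * Q0 q
        = (of_bool (p []) + 2 * Q1 (sect p [La]) + P0 p) + 2 * (P0 p * Q1 (sect q [La]))"
      by (simp add: Q0_rec algebra_simps)
    also have "of_bool (p []) + 2 * Q1 (sect p [La]) + P0 p = of_bool (\<not> p []) + 2 * Q1 (sect p [Lb])"
      by (subst u) (simp add: algebra_simps)
    finally show ?thesis using True
      by (simp add: Q0_rec[of "mul p q"] sect_mul act_letter_def algebra_simps)
  qed
  moreover have "2 ^ k dvd Q1 (mul (sect p [?t]) (sect q [La])) - (Q1 (sect p [?t]) + P0 p * Q1 (sect q [La]))"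
    using Q1_mul_cong[OF Suc.IH const_P_sect(1)[OF Suc.prems]] by (simp add: const_P_sect(2)[OF Suc.prems])
  ultimately show ?case by (simp only: pow2_Suc_dvd_double)
qed simp

lemma Q1_mul: "const_P p \<Longrightarrow> Q1 (mul p q) = Q1 p + P0 p * Q1 q"
  by (intro z2_eqI Q1_mul_cong Q0_mul_cong)

text \<open>Follows from the identity for \<open>Q1\<close> on the sections; an exchange in
  \<open>q\<close> interchanges the two sections of \<open>p\<close> and so turns the contribution
  of \<open>p\<close> into \<open>- P0 p\<close>.\<close>

lemma P0_mul:
  assumes p: "const_P p"
  shows "P0 (mul p q) = P0 p * P0 q"
proof -
  have Q1: "Q1 (sect (mul p q) [s]) = Q1 (sect p [act_letter (q []) s]) + P0 p * Q1 (sect q [s])" for s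
    by (simp add: sect_mul Q1_mul const_P_sect[OF p])
  show ?thesis
  proof (cases "q []")
    case False
    then have "P0 (mul p q) = P0 p + 2 * (P0 p * (Q1 (sect q [Lb]) - Q1 (sect q [La])))"
      by (simp add: P0_rec[of "mul p q"] P0_rec[of p] Q1 act_letter_def algebra_simps)
    also have "\<dots> = P0 p * P0 q"
      using False by (simp add: P0_rec[of q] algebra_simps)
    finally show ?thesis .
  next
    case True
    then have "P0 (mul p q) = - P0 p + 2 * (P0 p * (Q1 (sect q [Lb]) - Q1 (sect q [La])))"
      by (simp add: P0_rec[of "mul p q"] Q1 act_letter_def) (simp add: P0_rec[of p] algebra_simps)
    also have "\<dots> = P0 p * P0 q"
      using True by (simp add: P0_rec[of q] algebra_simps)
    finally show ?thesis .
  qed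
qed

lemma P0_sect_mul: "const_P p \<Longrightarrow> P0 (sect (mul p q) x) = P0 p * P0 (sect q x)"
  by (simp add: sect_mul P0_mul const_P_sect)

lemma const_P_mul: "const_P p \<Longrightarrow> const_P q \<Longrightarrow> const_P (mul p q)"
  by (simp add: const_P_def[of "mul p q"] P0_sect_mul P0_mul const_P_sect(2))

lemma const_P_one [simp]: "const_P (\<lambda>_. False)"
  by (simp add: const_P_def)

lemma mul_inv: "mul p (inv\<^bsub>portrait_group\<^esub> p) = (\<lambda>_. False)"
  "mul (inv\<^bsub>portrait_group\<^esub> p) p = (\<lambda>_. False)"
  using PG.r_inv[of p] PG.l_inv[of p] by (simp_all only: portrait_group_simps UNIV_I)

text \<open>Multiplicativity on the sections of \<open>p\<close> times its inverse makes every value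
  of P on the inverse an inverse of \<open>P0 p\<close>, hence constant.\<close>

lemma const_P_inv:
  assumes p: "const_P p"
  shows "const_P (inv\<^bsub>portrait_group\<^esub> p)" "P0 p * P0 (inv\<^bsub>portrait_group\<^esub> p) = 1"
proof -
  let ?q = "inv\<^bsub>portrait_group\<^esub> p"
  have 1: "P0 p * P0 (sect ?q x) = 1" for x
    using P0_sect_mul[OF p, of ?q x] unfolding mul_inv by simp
  from 1[of "[]"] show pq: "P0 p * P0 ?q = 1" by simp
  have "P0 (sect ?q x) = P0 ?q" for x
  proof -
    have "P0 (sect ?q x) = (P0 p * P0 ?q) * P0 (sect ?q x)" by (simp add: pq)
    also have "\<dots> = P0 ?q * (P0 p * P0 (sect ?q x))" by (simp only: ac_simps)
    finally show ?thesis by (simp add: 1)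
  qed
  then show "const_P ?q" by (simp add: const_P_def)
qed

lemma subgroup_const_P: "subgroup {p. const_P p} portrait_group"
  by (rule PG.subgroupI) (auto simp: const_P_mul const_P_inv(1) intro: exI[of _ "\<lambda>_. False"])

lemma subgroup_P_eq_1: "subgroup {p. const_P p \<and> P0 p = 1} portrait_group"
proof (rule PG.subgroupI)
  show "inv\<^bsub>portrait_group\<^esub> p \<in> {p. const_P p \<and> P0 p = 1}" if "p \<in> {p. const_P p \<and> P0 p = 1}" for p
    using that const_P_inv[of p] by auto
qed (auto simp: const_P_mul P0_mul intro: exI[of _ "\<lambda>_. False"])

section \<open>Finitely many levels determine Q and P modulo a power of 2\<close>

text \<open>\<open>Q0\<close> reads the levels 0, 2, 4, ... with weights 1, 2, 4, ..., so each
  further power of 2 costs two levels.\<close>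

lemma Q0_agree: "agree n p q \<Longrightarrow> 2 ^ ((n + 1) div 2) dvd Q0 p - Q0 q"
proof (induction n arbitrary: p q rule: less_induct)
  case (less n)
  show ?case
  proof (cases "n = 0")
    case False
    then have eq: "p [] = q []" using less.prems by (simp add: agree_def)
    have IH: "2 ^ ((n - 1) div 2) dvd Q0 (sect p [La, s]) - Q0 (sect q [La, s])" for s
    proof (cases "n = 1")
      case False
      with \<open>n \<noteq> 0\<close> have n: "n - length [La, s] < n" "n - length [La, s] + 1 = n - 1" by auto
      show ?thesis using less.IH[OF n(1) agree_sect[OF less.prems, of "[La, s]"]] unfolding n(2) .
    qed simp
    have "2 ^ ((n - 1) div 2) dvd (Q0 (sect p [La, La]) - Q0 (sect q [La, La])) + (Q0 (sect p [La, Lb]) - Q0 (sect q [La, Lb]))"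
      by (intro dvd_add IH)
    moreover have "Q0 p - Q0 q = 2 * ((Q0 (sect p [La, La]) - Q0 (sect q [La, La])) + (Q0 (sect p [La, Lb]) - Q0 (sect q [La, Lb])))"
      by (simp add: Q0_rec[of p] Q0_rec[of q] eq Q1_def algebra_simps)
    moreover have "(n + 1) div 2 = Suc ((n - 1) div 2)" using False by simp
    ultimately show ?thesis by (simp only: pow2_Suc_dvd_double)
  qed simp
qed

lemma Q1_agree:
  assumes "agree n p q"
  shows "2 ^ (n div 2) dvd Q1 p - Q1 q"
proof (cases "n = 0")
  case False
  have "2 ^ (n div 2) dvd Q0 (sect p [s]) - Q0 (sect q [s])" for s
    using Q0_agree[OF agree_sect[OF assms, of "[s]"]] False by simp
  then have "2 ^ (n div 2) dvd (Q0 (sect p [La]) - Q0 (sect q [La])) + (Q0 (sect p [Lb]) - Q0 (sect q [Lb]))"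
    by (intro dvd_add)
  then show ?thesis by (simp add: Q1_def algebra_simps)
qed simp

text \<open>The sections at the children determine \<open>Q1\<close> modulo
  \<open>2 ^ ((n - 1) div 2)\<close>, and the factor 2 gives one more power. This is the origin of
  the exponent in \<open>prec\<close>.\<close>

lemma P0_agree:
  assumes "agree n p q"
  shows "2 ^ ((n + 1) div 2) dvd P0 p - P0 q"
proof (cases "n = 0")
  case False
  then have eq: "p [] = q []" using assms by (simp add: agree_def)
  have Q1: "2 ^ ((n - 1) div 2) dvd Q1 (sect p [s]) - Q1 (sect q [s])" for s
    using Q1_agree[OF agree_sect[OF assms, of "[s]"]] by simp
  have "2 ^ ((n - 1) div 2) dvd (Q1 (sect p [Lb]) - Q1 (sect q [Lb])) - (Q1 (sect p [La]) - Q1 (sect q [La]))"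
    by (intro dvd_diff Q1)
  moreover have "P0 p - P0 q = 2 * ((Q1 (sect p [Lb]) - Q1 (sect q [Lb])) - (Q1 (sect p [La]) - Q1 (sect q [La])))"
    by (simp add: P0_rec eq algebra_simps)
  moreover have "(n + 1) div 2 = Suc ((n - 1) div 2)" using False by simp
  ultimately show ?thesis by (simp only: pow2_Suc_dvd_double)
qed simp

lemma P0_sect_agree:
  assumes "agree n p q"
  shows "2 ^ prec n x dvd P0 (sect p x) - P0 (sect q x)"
  using P0_agree[OF agree_sect[OF assms, of x]] by (simp add: prec_def)

lemma P0_odd: "z2_res (P0 p) 1 = 1"
proof -
  have "P0 p - 1 = 2 * ((if p [] then - 1 else 0) + (Q1 (sect p [Lb]) - Q1 (sect p [La])))"
    by (simp add: P0_rec)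
  then have "2 ^ 1 dvd P0 p - 1" by simp
  then have "z2_res (P0 p) 1 = z2_res 1 1" by (simp only: z2_res_eq_iff)
  then show ?thesis by (simp add: z2_res_one)
qed

section \<open>The Basilica group\<close>

definition node :: "bool \<Rightarrow> portrait \<Rightarrow> portrait \<Rightarrow> portrait" where
  "node e p q x = (case x of [] \<Rightarrow> e | La # y \<Rightarrow> p y | Lb # y \<Rightarrow> q y)"

lemma node_simps [simp]:
  "node e p q [] = e" "node e p q (La # y) = p y" "node e p q (Lb # y) = q y"
  by (simp_all add: node_def)

lemma sect_node [simp]: "sect (node e p q) [La] = p" "sect (node e p q) [Lb] = q"
  by (simp_all add: sect_def)

lemma portrait_eqI:
  assumes "p [] = q []" "sect p [La] = sect q [La]" "sect p [Lb] = sect q [Lb]"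
  shows "p = q"
proof
  fix x show "p x = q x"
  proof (cases x)
    case (Cons s y)
    then show ?thesis
      using fun_cong[OF assms(2), of y] fun_cong[OF assms(3), of y] by (cases s) (simp_all add: sect_def)
  qed (simp add: assms(1))
qed

lemma node_eta: "node (p []) (sect p [La]) (sect p [Lb]) = p"
  by (rule portrait_eqI) simp_all

lemma node_one [simp]: "node False (\<lambda>_. False) (\<lambda>_. False) = (\<lambda>_. False)"
  by (rule portrait_eqI) simp_all

lemma mul_node:
  "mul (node e p q) (node f r s)
     = node (f \<noteq> e) (mul (if f then q else p) r) (mul (if f then p else q) s)"
  by (rule portrait_eqI) (simp_all add: sect_mul act_letter_def)

lemma mul_one [simp]: "mul p (\<lambda>_. False) = p" "mul (\<lambda>_. False) p = p"
  by (simp_all add: mul_def)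

lemma inv_node: "inv\<^bsub>portrait_group\<^esub> (node False p q)
    = node False (inv\<^bsub>portrait_group\<^esub> p) (inv\<^bsub>portrait_group\<^esub> q)"
  by (rule PG.inv_equality) (simp_all add: mul_node mul_inv)

lemma agree_node:
  "agree n p p' \<Longrightarrow> agree n q q' \<Longrightarrow> agree (Suc n) (node e p q) (node e p' q')"
  unfolding agree_def
proof (intro allI impI)
  fix x :: word
  assume *: "\<forall>x. length x < n \<longrightarrow> p x = p' x" "\<forall>x. length x < n \<longrightarrow> q x = q' x" "length x < Suc n"
  show "node e p q x = node e p' q' x"
  proof (cases x)
    case (Cons s y)
    with * show ?thesis by (cases s) auto
  qed simp
qed

definition port_alpha :: portrait where
  "port_alpha x \<longleftrightarrow> (\<exists>k. even k \<and> x = replicate k Lb)"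

definition port_beta :: portrait where
  "port_beta x \<longleftrightarrow> (\<exists>k. odd k \<and> x = replicate k Lb)"

lemma ex_replicate_Cons:
  "(\<exists>k. R k \<and> s # x = replicate k t) \<longleftrightarrow> s = t \<and> (\<exists>k. R (Suc k) \<and> x = replicate k t)"
proof
  assume "\<exists>k. R k \<and> s # x = replicate k t"
  then obtain k where "R k" "s # x = replicate k t" by blast
  then show "s = t \<and> (\<exists>k. R (Suc k) \<and> x = replicate k t)" by (cases k) auto
next
  assume "s = t \<and> (\<exists>k. R (Suc k) \<and> x = replicate k t)"
  then show "\<exists>k. R k \<and> s # x = replicate k t" by (metis replicate_Suc)
qed

text \<open>Removing one letter from a power of \<open>Lb\<close> switches the parity of its
  exponent, so \<alpha> and \<beta> are each other's section at \<open>Lb\<close>.\<close>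

lemma port_alpha_rec: "port_alpha = node True (\<lambda>_. False) port_beta"
  by (rule portrait_eqI) (auto simp: sect_def port_alpha_def port_beta_def ex_replicate_Cons intro!: ext exI[of _ 0])

lemma port_beta_rec: "port_beta = node False (\<lambda>_. False) port_alpha"
  by (rule portrait_eqI) (auto simp: sect_def port_alpha_def port_beta_def ex_replicate_Cons intro!: ext)

lemma aut_of_Par_act: "aut_of_Par (\<lambda>x. of_bool (p x)) = act p"
  unfolding aut_of_Par_def
proof (rule the_equality)
  show "act p \<in> carrier (tree_aut UNIV) \<and> (\<forall>x. Par (act p) x = of_bool (p x))"
    by (simp add: carrier_tree_aut Par_act)
next
  fix \<sigma> assume \<sigma>: "\<sigma> \<in> carrier (tree_aut UNIV) \<and> (\<forall>x. Par \<sigma> x = of_bool (p x))"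
  then obtain q where q: "\<sigma> = act q" by (auto simp: carrier_tree_aut)
  with \<sigma> have "(of_bool (q x) :: nat) = of_bool (p x)" for x by (metis Par_act)
  then have "q x = p x" for x by (metis of_bool_eq_iff)
  with q show "\<sigma> = act p" by (auto intro!: arg_cong[of _ _ act])
qed

lemma basilica_alpha_eq: "basilica_alpha = act port_alpha"
  unfolding basilica_alpha_def aut_of_Par_act[symmetric] port_alpha_def of_bool_def ..

lemma basilica_beta_eq: "basilica_beta = act port_beta"
  unfolding basilica_beta_def aut_of_Par_act[symmetric] port_beta_def of_bool_def ..

definition port_basilica :: "portrait set" where
  "port_basilica = generate portrait_group {port_alpha, port_beta}"

lemma basilica_eq: "basilica = act ` port_basilica"
proof -
  interpret group_hom portrait_group "tree_aut UNIV" act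
    using aut_on_hom[of UNIV] group_tree_aut[of UNIV]
    by (intro group_hom.intro PG.is_group group_hom_axioms.intro) (simp_all add: ext[of "aut_on UNIV" act])
  show ?thesis
    using generate_img[of "{port_alpha, port_beta}"]
    by (simp add: basilica_def port_basilica_def basilica_alpha_eq basilica_beta_eq)
qed

lemma subgroup_basilica: "subgroup port_basilica portrait_group"
  unfolding port_basilica_def by (rule PG.generate_is_subgroup) simp

lemma alpha_in_basilica: "port_alpha \<in> port_basilica" and beta_in_basilica: "port_beta \<in> port_basilica"
  by (auto simp: port_basilica_def intro: generate.incl)

lemma mul_in_basilica: "p \<in> port_basilica \<Longrightarrow> q \<in> port_basilica \<Longrightarrow> mul p q \<in> port_basilica"
  using subgroup.m_closed[OF subgroup_basilica, of p q] by simp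

lemma inv_in_basilica: "p \<in> port_basilica \<Longrightarrow> inv\<^bsub>portrait_group\<^esub> p \<in> port_basilica"
  by (rule subgroup.m_inv_closed[OF subgroup_basilica])

lemma one_in_basilica: "(\<lambda>_. False) \<in> port_basilica"
  using subgroup.one_closed[OF subgroup_basilica] by simp

lemma sect_alpha [simp]: "port_alpha []" "sect port_alpha [La] = (\<lambda>_. False)" "sect port_alpha [Lb] = port_beta"
  by (subst port_alpha_rec, simp)+

lemma sect_beta [simp]: "\<not> port_beta []" "sect port_beta [La] = (\<lambda>_. False)" "sect port_beta [Lb] = port_alpha"
  by (subst port_beta_rec, simp)+

lemma Q_alpha_beta:
  "Q0 port_alpha = 1" "Q0 port_beta = 0" "Q1 port_alpha = 0" "Q1 port_beta = 1"
proof -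
  show a: "Q0 port_alpha = 1" and b: "Q0 port_beta = 0" by (simp_all add: Q0_rec)
  show "Q1 port_alpha = 0" "Q1 port_beta = 1" by (simp_all add: Q1_def a b)
qed

lemma P_alpha_beta: "P0 port_alpha = 1" "P0 port_beta = 1"
  by (simp_all add: P0_rec Q_alpha_beta)

text \<open>The generators form a finite automaton: every section is \<alpha>, \<beta> or trivial,
  and P is 1 on all three.\<close>

lemma const_P_alpha_beta: "const_P port_alpha" "const_P port_beta"
proof -
  let ?S = "{port_alpha, port_beta, \<lambda>_. False}"
  have step: "sect q [s] \<in> ?S" if "q \<in> ?S" for q s
    using that by (cases s) auto
  have "sect p x \<in> ?S" if "p \<in> ?S" for p x
  proof (induction x rule: rev_induct)
    case (snoc s x)
    then show ?case using step[of "sect p x" s] by simp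
  qed (use that in simp)
  moreover have "P0 q = 1" if "q \<in> ?S" for q
    using that by (auto simp: P_alpha_beta)
  ultimately have "P0 (sect p x) = 1" if "p \<in> ?S" for p x
    using that by simp
  then show "const_P port_alpha" "const_P port_beta"
    by (simp_all add: const_P_def P_alpha_beta)
qed

lemma basilica_P: "port_basilica \<subseteq> {p. const_P p \<and> P0 p = 1}"
  unfolding port_basilica_def
  by (rule PG.generate_subgroup_incl[OF _ subgroup_P_eq_1]) (simp add: const_P_alpha_beta P_alpha_beta)

section \<open>Pairs of sections in the Basilica group\<close>

lemma right_one: "node False (\<lambda>_. False) (\<lambda>_. False) \<in> port_basilica"
  using one_in_basilica by simp

lemma subgroup_right: "subgroup {g. node False (\<lambda>_. False) g \<in> port_basilica} portrait_group"
proof (rule PG.subgroupI)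
  fix g h assume g: "g \<in> {g. node False (\<lambda>_. False) g \<in> port_basilica}"
  then show "inv\<^bsub>portrait_group\<^esub> g \<in> {g. node False (\<lambda>_. False) g \<in> port_basilica}"
    using inv_in_basilica[of "node False (\<lambda>_. False) g"] PG.inv_one by (simp add: inv_node)
  assume "h \<in> {g. node False (\<lambda>_. False) g \<in> port_basilica}"
  with g show "g \<otimes>\<^bsub>portrait_group\<^esub> h \<in> {g. node False (\<lambda>_. False) g \<in> port_basilica}"
    using mul_in_basilica[of "node False (\<lambda>_. False) g" "node False (\<lambda>_. False) h"] by (simp add: mul_node)
next
  show "{g. node False (\<lambda>_. False) g \<in> port_basilica} \<noteq> {}"
    using one_in_basilica by (auto intro!: exI[of _ "\<lambda>_. False"])
qed simp

lemma subgroup_diag: "subgroup {g. node False g g \<in> port_basilica} portrait_group"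
proof (rule PG.subgroupI)
  fix g h assume g: "g \<in> {g. node False g g \<in> port_basilica}"
  then show "inv\<^bsub>portrait_group\<^esub> g \<in> {g. node False g g \<in> port_basilica}"
    using inv_in_basilica[of "node False g g"] by (simp add: inv_node)
  assume "h \<in> {g. node False g g \<in> port_basilica}"
  with g show "g \<otimes>\<^bsub>portrait_group\<^esub> h \<in> {g. node False g g \<in> port_basilica}"
    using mul_in_basilica[of "node False g g" "node False h h"] by (simp add: mul_node)
next
  show "{g. node False g g \<in> port_basilica} \<noteq> {}"
    using one_in_basilica by (auto intro!: exI[of _ "\<lambda>_. False"])
qed simp

lemma alpha_squared: "mul port_alpha port_alpha = node False port_beta port_beta"
proof -
  have "mul (node True (\<lambda>_. False) port_beta) (node True (\<lambda>_. False) port_beta) = node False port_beta port_beta"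
    by (simp add: mul_node)
  then show ?thesis by (simp only: port_alpha_rec[symmetric])
qed

abbreviation beta_pow :: "int \<Rightarrow> portrait" where
  "beta_pow k \<equiv> port_beta [^]\<^bsub>portrait_group\<^esub> k"

lemma beta_pow_add: "beta_pow (k + l) = mul (beta_pow k) (beta_pow l)"
  using PG.int_pow_mult[of port_beta k l] by simp

lemma diag_beta_pow: "node False (beta_pow k) (beta_pow k) \<in> port_basilica"
proof -
  have "port_beta \<in> {g. node False g g \<in> port_basilica}"
    using mul_in_basilica[OF alpha_in_basilica alpha_in_basilica] by (simp add: alpha_squared)
  from PG.subgroup_int_pow_closed[OF subgroup_diag this] show ?thesis by simp
qed

text \<open>Makes the admissible second coordinates stable under conjugation by powers of \<beta>,
  which are diagonal coordinates because \<open>\<alpha>^2 = (\<beta>, \<beta>)\<close>.\<close>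

lemma right_conj:
  assumes g: "node False g g \<in> port_basilica" and n: "node False (\<lambda>_. False) n \<in> port_basilica"
  shows "node False (\<lambda>_. False) (mul (mul g n) (inv\<^bsub>portrait_group\<^esub> g)) \<in> port_basilica"
proof -
  have "mul (mul (node False g g) (node False (\<lambda>_. False) n)) (inv\<^bsub>portrait_group\<^esub> (node False g g))
      = node False (\<lambda>_. False) (mul (mul g n) (inv\<^bsub>portrait_group\<^esub> g))"
    by (simp add: inv_node mul_node mul_inv)
  moreover have "mul (mul (node False g g) (node False (\<lambda>_. False) n)) (inv\<^bsub>portrait_group\<^esub> (node False g g))
      \<in> port_basilica"
    by (intro mul_in_basilica inv_in_basilica assms)
  ultimately show ?thesis by simp
qed

text \<open>Conjugation by \<open>\<alpha>\<close> exchanges the two coordinates, up to conjugation by \<open>\<beta>\<close>.\<close>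

lemma left_if_right:
  assumes n: "node False (\<lambda>_. False) n \<in> port_basilica"
  shows "node False n (\<lambda>_. False) \<in> port_basilica"
proof -
  let ?i = "inv\<^bsub>portrait_group\<^esub> port_beta"
  \<comment> \<open>Chosen so that \<open>\<beta> m = n \<beta>\<close>; then conjugating
    \<open>(1, m)\<close> by \<alpha> gives \<open>(n, 1)\<close>.\<close>
  define m where "m = mul (mul ?i n) (inv\<^bsub>portrait_group\<^esub> ?i)"
  have "port_beta \<in> {g. node False g g \<in> port_basilica}"
    using diag_beta_pow[of 1] PG.int_pow_1[of port_beta] by simp
  from subgroup.m_inv_closed[OF subgroup_diag this]
  have m: "node False (\<lambda>_. False) m \<in> port_basilica"
    unfolding m_def mem_Collect_eq by (rule right_conj[OF _ n])
  have "m = mul (mul ?i n) port_beta"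
    unfolding m_def using PG.inv_inv[of port_beta] by simp
  then have "mul port_beta m = mul n port_beta"
    by (simp only: mul_assoc[symmetric] mul_inv mul_one)
  then have "mul port_alpha (node False (\<lambda>_. False) m) = mul (node False n (\<lambda>_. False)) port_alpha"
    unfolding port_alpha_rec by (simp add: mul_node)
  then have "node False n (\<lambda>_. False)
      = mul (mul port_alpha (node False (\<lambda>_. False) m)) (inv\<^bsub>portrait_group\<^esub> port_alpha)"
    by (simp add: mul_assoc mul_inv)
  then show ?thesis
    using m by (auto intro: mul_in_basilica inv_in_basilica alpha_in_basilica)
qed

text \<open>The normal closure of \<open>\<alpha>\<close> embeds into the group as a second coordinate, since \<open>\<beta> = (1, \<alpha>)\<close>
  and \<open>\<alpha>\<^sup>2 = (\<beta>, \<beta>)\<close>; the \<open>\<beta>\<close>-exponent is what remains.\<close>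

lemma basilica_decomp:
  assumes "g \<in> port_basilica"
  shows "\<exists>n k. node False (\<lambda>_. False) n \<in> port_basilica \<and> g = mul n (beta_pow k) \<and> Q1 g = of_int k"
  using assms unfolding port_basilica_def
proof (induction rule: generate.induct)
  case one
  have "\<one>\<^bsub>portrait_group\<^esub> = mul (\<lambda>_. False) (beta_pow 0)" "Q1 \<one>\<^bsub>portrait_group\<^esub> = of_int 0"
    using int_pow_0[of portrait_group port_beta] by simp_all
  then show ?case using right_one unfolding port_basilica_def by blast
next
  case (incl h)
  then consider "h = port_alpha" | "h = port_beta" by blast
  then show ?case
  proof cases
    case 1
    have "h = mul h (beta_pow 0)" using int_pow_0[of portrait_group port_beta] by simp
    moreover have "node False (\<lambda>_. False) h \<in> port_basilica"
      using beta_in_basilica 1 by (simp add: port_beta_rec[symmetric])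
    moreover have "Q1 h = of_int 0" using 1 Q_alpha_beta by simp
    ultimately show ?thesis unfolding port_basilica_def by blast
  next
    case 2
    have "h = mul (\<lambda>_. False) (beta_pow 1)" using PG.int_pow_1[of port_beta] 2 by simp
    moreover have "Q1 h = of_int 1" using 2 Q_alpha_beta by simp
    ultimately show ?thesis using right_one unfolding port_basilica_def by blast
  qed
next
  case (inv h)
  have Q1: "Q1 (inv\<^bsub>portrait_group\<^esub> p) = - Q1 p" if "const_P p" "P0 p = 1" for p
    using Q1_mul[OF that(1), of "inv\<^bsub>portrait_group\<^esub> p"] that(2)
    by (simp add: mul_inv eq_neg_iff_add_eq_0 add.commute)
  from inv consider "h = port_alpha" | "h = port_beta" by blast
  then show ?case
  proof cases
    case 1
    have "inv\<^bsub>portrait_group\<^esub> h = mul (inv\<^bsub>portrait_group\<^esub> h) (beta_pow 0)"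
      using int_pow_0[of portrait_group port_beta] by simp
    moreover have "node False (\<lambda>_. False) (inv\<^bsub>portrait_group\<^esub> h) \<in> port_basilica"
      using subgroup.m_inv_closed[OF subgroup_right, of port_alpha] beta_in_basilica 1
      by (simp add: port_beta_rec[symmetric])
    moreover have "Q1 (inv\<^bsub>portrait_group\<^esub> h) = of_int 0"
      using 1 Q1[OF const_P_alpha_beta(1) P_alpha_beta(1)] Q_alpha_beta by simp
    ultimately show ?thesis unfolding port_basilica_def by blast
  next
    case 2
    have "inv\<^bsub>portrait_group\<^esub> h = mul (\<lambda>_. False) (beta_pow (- 1))"
      using PG.int_pow_neg[of port_beta 1] PG.int_pow_1[of port_beta] 2 by simp
    moreover have "Q1 (inv\<^bsub>portrait_group\<^esub> h) = of_int (- 1)"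
      using 2 Q1[OF const_P_alpha_beta(2) P_alpha_beta(2)] Q_alpha_beta by simp
    ultimately show ?thesis using right_one unfolding port_basilica_def by blast
  qed
next
  case (eng g h)
  then obtain m k n l where
    m: "node False (\<lambda>_. False) m \<in> port_basilica" "g = mul m (beta_pow k)" "Q1 g = of_int k" and
    n: "node False (\<lambda>_. False) n \<in> port_basilica" "h = mul n (beta_pow l)" "Q1 h = of_int l"
    unfolding port_basilica_def by blast
  \<comment> \<open>Conjugating \<open>n\<close> moves \<open>\<beta>^k\<close> to the right past
    it, so that the exponents can be added.\<close>
  define n' where "n' = mul (mul (beta_pow k) n) (inv\<^bsub>portrait_group\<^esub> (beta_pow k))"
  have n': "node False (\<lambda>_. False) n' \<in> port_basilica"
    unfolding n'_def by (rule right_conj[OF diag_beta_pow n(1)])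
  have "mul (beta_pow k) n = mul n' (beta_pow k)"
    unfolding n'_def by (simp add: mul_assoc mul_inv)
  then have "mul g h = mul (mul m n') (beta_pow (k + l))"
    unfolding m(2) n(2) beta_pow_add by (metis mul_assoc)
  moreover have "node False (\<lambda>_. False) (mul m n') \<in> port_basilica"
    using mul_in_basilica[OF m(1) n'] by (simp add: mul_node)
  moreover have "Q1 (mul g h) = of_int (k + l)"
    using basilica_P eng(1) Q1_mul[of g h] m(3) n(3) by (auto simp: port_basilica_def)
  ultimately show ?case unfolding port_basilica_def portrait_group_simps by blast
qed

text \<open>The product \<open>(m, 1) (1, n) (\<beta>^k, \<beta>^k)\<close>: the coordinates are
  independent up to their common \<beta>-exponent.\<close>

lemma node_in_basilica:
  assumes "node False (\<lambda>_. False) m \<in> port_basilica" "node False (\<lambda>_. False) n \<in> port_basilica"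
  shows "node False (mul m (beta_pow k)) (mul n (beta_pow k)) \<in> port_basilica"
proof -
  have "mul (mul (node False m (\<lambda>_. False)) (node False (\<lambda>_. False) n)) (node False (beta_pow k) (beta_pow k))
      \<in> port_basilica"
    by (intro mul_in_basilica left_if_right assms diag_beta_pow)
  then show ?thesis by (simp add: mul_node)
qed

section \<open>Approximation by the Basilica group on finite levels\<close>

lemma subgroup_agree_one: "subgroup {p. agree n p (\<lambda>_. False)} portrait_group"
proof (rule PG.subgroupI)
  fix p q assume p: "p \<in> {p. agree n p (\<lambda>_. False)}"
  then have "agree n (mul p (inv\<^bsub>portrait_group\<^esub> p)) (mul (\<lambda>_. False) (inv\<^bsub>portrait_group\<^esub> p))"
    by (intro agree_mul) auto
  then show "inv\<^bsub>portrait_group\<^esub> p \<in> {p. agree n p (\<lambda>_. False)}"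
    by (simp add: mul_inv agree_sym)
  assume "q \<in> {p. agree n p (\<lambda>_. False)}"
  with p show "p \<otimes>\<^bsub>portrait_group\<^esub> q \<in> {p. agree n p (\<lambda>_. False)}"
    using agree_mul[of n p "\<lambda>_. False" q "\<lambda>_. False"] by simp
qed (auto intro: exI[of _ "\<lambda>_. False"])

lemma pow_node: "node False p q [^]\<^bsub>portrait_group\<^esub> (k::nat)
    = node False (p [^]\<^bsub>portrait_group\<^esub> k) (q [^]\<^bsub>portrait_group\<^esub> k)"
  by (induction k) (simp_all add: mul_node)

text \<open>By \<open>\<alpha>^2 = (\<beta>, \<beta>)\<close> and
  \<open>\<beta> = (1, \<alpha>)\<close>, squaring \<alpha> passes to \<beta> one level down, and
  powers of \<beta> are powers of \<alpha> one level further down. Each doubling of the exponent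
  thus trivialises two more levels.\<close>

lemma pow_agree_one:
  "agree (2 * k) (port_alpha [^]\<^bsub>portrait_group\<^esub> (2 ^ k :: nat)) (\<lambda>_. False)
   \<and> agree (2 * k + 1) (port_beta [^]\<^bsub>portrait_group\<^esub> (2 ^ k :: nat)) (\<lambda>_. False)"
proof (induction k)
  case 0
  then show ?case by (simp add: agree_def)
next
  case (Suc k)
  have "port_alpha [^]\<^bsub>portrait_group\<^esub> (2 ^ Suc k :: nat)
      = (port_alpha [^]\<^bsub>portrait_group\<^esub> (2::nat)) [^]\<^bsub>portrait_group\<^esub> (2 ^ k :: nat)"
    using PG.nat_pow_pow[of port_alpha 2 "2 ^ k"] by simp
  also have "port_alpha [^]\<^bsub>portrait_group\<^esub> (2::nat) = node False port_beta port_beta"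
    by (simp add: numeral_2_eq_2 alpha_squared)
  finally have a: "port_alpha [^]\<^bsub>portrait_group\<^esub> (2 ^ Suc k :: nat)
      = node False (port_beta [^]\<^bsub>portrait_group\<^esub> (2 ^ k :: nat)) (port_beta [^]\<^bsub>portrait_group\<^esub> (2 ^ k :: nat))"
    by (simp only: pow_node)
  have alpha: "agree (2 * Suc k) (port_alpha [^]\<^bsub>portrait_group\<^esub> (2 ^ Suc k :: nat)) (\<lambda>_. False)"
    using agree_node[OF conjunct2[OF Suc.IH] conjunct2[OF Suc.IH], of False] by (simp only: a node_one) simp
  have "port_beta [^]\<^bsub>portrait_group\<^esub> (2 ^ Suc k :: nat)
      = node False ((\<lambda>_. False) [^]\<^bsub>portrait_group\<^esub> (2 ^ Suc k :: nat)) (port_alpha [^]\<^bsub>portrait_group\<^esub> (2 ^ Suc k :: nat))"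
    by (subst port_beta_rec) (rule pow_node)
  also have "(\<lambda>_. False) [^]\<^bsub>portrait_group\<^esub> (2 ^ Suc k :: nat) = (\<lambda>_. False)"
    using PG.nat_pow_one[of "2 ^ Suc k"] by simp
  finally have "agree (2 * Suc k + 1) (port_beta [^]\<^bsub>portrait_group\<^esub> (2 ^ Suc k :: nat)) (\<lambda>_. False)"
    using agree_node[OF agree_refl alpha, of False "\<lambda>_. False"] by simp
  with alpha show ?case by blast
qed

lemma beta_pow_agree_one:
  assumes "2 ^ (n div 2) dvd k"
  shows "agree n (beta_pow k) (\<lambda>_. False)"
proof -
  let ?N = "2 ^ (n div 2) :: nat"
  from assms obtain m where k: "k = int ?N * m" by (auto elim: dvdE)
  have "beta_pow k = (beta_pow (int ?N)) [^]\<^bsub>portrait_group\<^esub> m"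
    unfolding k by (rule PG.int_pow_pow[symmetric]) simp
  \<comment> \<open>The power is trivial on \<open>2 * (n div 2) + 1\<close> levels, which is at
    least \<open>n\<close>.\<close>
  moreover have "agree n (beta_pow (int ?N)) (\<lambda>_. False)"
    unfolding int_pow_int by (rule agree_mono[OF conjunct2[OF pow_agree_one]]) simp
  ultimately show ?thesis
    using PG.subgroup_int_pow_closed[OF subgroup_agree_one, of "beta_pow (int ?N)" n m] by simp
qed

lemma prec_Cons [simp]: "prec (Suc n) (s # x) = prec n x"
  by (simp add: prec_def)

text \<open>Density of the Basilica group in the portraits with P equal to 1. The sections are
  approximated by induction; the condition at the root makes their \<beta>-exponents congruent
  modulo \<open>2 ^ (n div 2)\<close>, so one of them can be adjusted without effect on the first
  \<open>n\<close> levels.\<close>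

lemma basilica_approx:
  assumes "\<And>x. length x \<le> n \<Longrightarrow> 2 ^ prec n x dvd P0 (sect p x) - 1"
  shows "\<exists>b\<in>port_basilica. agree n b p"
  using assms
proof (induction n arbitrary: p)
  case 0
  show ?case using one_in_basilica by (auto simp: agree_def)
next
  case (Suc n)
  have even_case: "\<exists>b\<in>port_basilica. agree (Suc n) b p"
    if p: "\<not> p []" and P: "\<And>x. length x \<le> Suc n \<Longrightarrow> 2 ^ prec (Suc n) x dvd P0 (sect p x) - 1" for p
  proof -
    define g h where "g = sect p [La]" and "h = sect p [Lb]"
    have "\<exists>b\<in>port_basilica. agree n b (sect p [s])" for s
    proof (rule Suc.IH)
      fix x :: word assume "length x \<le> n"
      then show "2 ^ prec n x dvd P0 (sect (sect p [s]) x) - 1"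
        using P[of "s # x"] by simp
    qed
    then obtain g' h' where g': "g' \<in> port_basilica" "agree n g' g" and h': "h' \<in> port_basilica" "agree n h' h"
      unfolding g_def h_def by blast
    obtain m k where m: "node False (\<lambda>_. False) m \<in> port_basilica" "g' = mul m (beta_pow k)" "Q1 g' = of_int k"
      using basilica_decomp[OF g'(1)] by blast
    obtain n' l where n': "node False (\<lambda>_. False) n' \<in> port_basilica" "h' = mul n' (beta_pow l)" "Q1 h' = of_int l"
      using basilica_decomp[OF h'(1)] by blast
    have "2 ^ Suc (n div 2) dvd P0 p - 1"
      using P[of "[]"] by (simp add: prec_def)
    also have "P0 p - 1 = 2 * (Q1 h - Q1 g)"
      using p by (simp add: P0_rec g_def h_def)
    finally have "2 ^ (n div 2) dvd Q1 h - Q1 g"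
      by (simp only: pow2_Suc_dvd_double)
    \<comment> \<open>The approximations have the same \<open>Q1\<close> as the sections modulo
      \<open>2 ^ (n div 2)\<close>, so the integer exponents \<open>k\<close> and \<open>l\<close>
      inherit the congruence.\<close>
    then have "2 ^ (n div 2) dvd (Q1 g' - Q1 g) - (Q1 h' - Q1 h) - (Q1 h - Q1 g)"
      by (rule dvd_diff[OF dvd_diff[OF Q1_agree[OF g'(2)] Q1_agree[OF h'(2)]]])
    then have "2 ^ (n div 2) dvd (of_int (k - l) :: z2adic)"
      by (simp add: m(3) n'(3))
    then have "agree n (beta_pow (k - l)) (\<lambda>_. False)"
      by (intro beta_pow_agree_one) (simp only: pow2_dvd_of_int_z2)
    then have "agree n (mul h' (beta_pow (k - l))) (mul h (\<lambda>_. False))"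
      by (intro agree_mul h'(2))
    \<comment> \<open>Multiplying by \<open>\<beta>^(k - l)\<close>, trivial on the first
      \<open>n\<close> levels, replaces the exponent \<open>l\<close> of \<open>h'\<close> by
      \<open>k\<close>.\<close>
    moreover have "mul h' (beta_pow (k - l)) = mul n' (beta_pow k)"
      using beta_pow_add[of l "k - l"] by (simp add: n'(2) mul_assoc)
    ultimately have "agree n (mul n' (beta_pow k)) h" by simp
    then have "agree (Suc n) (node False (mul m (beta_pow k)) (mul n' (beta_pow k))) (node False g h)"
      using g'(2) m(2) by (intro agree_node) simp_all
    moreover have "node False g h = p"
      using node_eta[of p] p by (simp add: g_def h_def)
    ultimately show ?thesis using node_in_basilica[OF m(1) n'(1)] by blast
  qed
  show ?case
  proof (cases "p []")
    case False
    then show ?thesis using even_case Suc.prems by blast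
  next
    case True
    \<comment> \<open>An exchange at the root is removed by dividing by \<alpha>, which does not
      change P.\<close>
    let ?i = "inv\<^bsub>portrait_group\<^esub> port_alpha"
    have i: "const_P ?i" "P0 ?i = 1"
      using subgroup.m_inv_closed[OF subgroup_P_eq_1, of port_alpha] const_P_alpha_beta P_alpha_beta by auto
    have "mul port_alpha ?i []= False" unfolding mul_inv ..
    then have "?i []" by simp
    have "\<exists>b\<in>port_basilica. agree (Suc n) b (mul ?i p)"
      by (rule even_case) (use Suc.prems True \<open>?i []\<close> in \<open>simp_all add: P0_sect_mul i\<close>)
    then obtain b where b: "b \<in> port_basilica" "agree (Suc n) b (mul ?i p)" by blast
    have "agree (Suc n) (mul port_alpha b) (mul port_alpha (mul ?i p))"
      by (intro agree_mul agree_refl b)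
    then have "agree (Suc n) (mul port_alpha b) p"
      by (simp only: mul_assoc[symmetric] mul_inv mul_one)
    then show ?thesis using mul_in_basilica[OF alpha_in_basilica b(1)] by blast
  qed
qed

section \<open>The groups of infinite level\<close>

abbreviation z2_odd :: "z2adic \<Rightarrow> bool" where
  "z2_odd x \<equiv> z2_res x 1 = 1"

definition z2_half :: "z2adic \<Rightarrow> z2adic" where
  "z2_half x = (SOME y. x = of_bool (z2_odd x) + 2 * y)"

lemma z2_half: "of_bool (z2_odd x) + 2 * z2_half x = x"
proof -
  have "\<exists>y. x = of_bool (z2_odd x) + 2 * y"
  proof (cases "z2_odd x")
    case True
    then have "z2_res (x - 1) 1 = 0" by (simp add: z2_res_diff z2_res_one)
    then obtain y where "x - 1 = 2 * y" using z2_even_imp_double by blast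
    with True show ?thesis by (auto simp: algebra_simps)
  next
    case False
    then show ?thesis using z2_odd_cases[of x] z2_even_imp_double[of x] by auto
  qed
  then show ?thesis unfolding z2_half_def by (metis (mono_tags, lifting) someI_ex)
qed

text \<open>The state \<open>(q, r)\<close> at a node is the pair of values that \<open>Q0\<close> and \<open>Q1\<close> of the section there
  shall take. The states of the children are the solution of the recursions for \<open>Q0\<close>, \<open>P0\<close> and
  \<open>Q1\<close>; the split of \<open>r\<close> as \<open>r + 0\<close> is an arbitrary choice.\<close>

fun realise_state :: "z2adic \<Rightarrow> z2adic \<times> z2adic \<Rightarrow> word \<Rightarrow> z2adic \<times> z2adic" where
  "realise_state u (q, r) [] = (q, r)"
| "realise_state u (q, r) (La # y) = realise_state u (r, z2_half q) y"
| "realise_state u (q, r) (Lb # y)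
     = realise_state u (0, z2_half q + z2_half (if z2_odd q then u + 1 else u - 1)) y"

definition realise :: "z2adic \<Rightarrow> z2adic \<times> z2adic \<Rightarrow> portrait" where
  "realise u s x = z2_odd (fst (realise_state u s x))"

lemma realise_root [simp]: "realise u (q, r) [] = z2_odd q"
  by (simp add: realise_def)

lemma sect_realise:
  "sect (realise u (q, r)) [La] = realise u (r, z2_half q)"
  "sect (realise u (q, r)) [Lb]
     = realise u (0, z2_half q + z2_half (if z2_odd q then u + 1 else u - 1))"
  by (rule ext, simp add: realise_def sect_apply)+

text \<open>The grandchildren below \<open>La\<close> are given the values \<open>z2_half q\<close>
  and \<open>0\<close> for \<open>Q0\<close>, whose sum is what the recursion requires; the factor 2
  drives the induction.\<close>

lemma Q0_realise_cong: "2 ^ k dvd Q0 (realise u (q, r)) - q"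
proof (induction k arbitrary: q r)
  case (Suc k)
  let ?h = "z2_half q"
  let ?s = "(0, z2_half r + z2_half (if z2_odd r then u + 1 else u - 1))"
  have "2 ^ k dvd (Q0 (realise u (?h, z2_half r)) - ?h) + (Q0 (realise u ?s) - 0)"
    by (intro dvd_add Suc.IH)
  moreover have "Q0 (realise u (q, r)) - (of_bool (z2_odd q) + 2 * ?h)
      = 2 * ((Q0 (realise u (?h, z2_half r)) - ?h) + (Q0 (realise u ?s) - 0))"
    by (subst Q0_rec) (simp add: sect_realise(1) Q1_def sect_realise algebra_simps del: sect_sect)
  ultimately show ?case by (simp only: z2_half pow2_Suc_dvd_double)
qed simp

lemma Q0_realise: "Q0 (realise u (q, r)) = q"
  by (intro z2_eqI Q0_realise_cong)

lemma Q1_realise: "Q1 (realise u (q, r)) = r"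
  by (simp add: Q1_def sect_realise Q0_realise)

text \<open>For odd \<open>u\<close> the numbers \<open>u + 1\<close> and \<open>u - 1\<close> are
  even, so the half is exact; it is the difference of the values of \<open>Q1\<close> on the two
  children.\<close>

lemma P0_realise:
  assumes "z2_odd u"
  shows "P0 (realise u s) = u"
proof -
  obtain q r where s: "s = (q, r)" by force
  let ?v = "if z2_odd q then u + 1 else u - 1"
  have "\<not> z2_odd ?v"
    using assms by (auto simp: z2_res_add z2_res_diff z2_res_one)
  then have "2 * z2_half ?v = ?v" using z2_half[of ?v] by simp
  then show ?thesis
    by (simp add: s P0_rec sect_realise Q1_realise)
qed

lemma sect_realise_ex: "\<exists>s'. sect (realise u s) x = realise u s'"
proof (induction x arbitrary: s)
  case (Cons t x)
  obtain q r where s: "s = (q, r)" by force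
  have "\<exists>s'. sect (realise u s) [t] = realise u s'"
    by (cases t) (auto simp: s sect_realise)
  then obtain s' where "sect (realise u s) [t] = realise u s'" ..
  then have "sect (realise u s) (t # x) = sect (realise u s') x"
    by (metis append_Cons append_Nil sect_sect)
  with Cons.IH show ?case by metis
qed auto

text \<open>All sections of a realised portrait are realised with the same \<open>u\<close>, so P is
  constantly \<open>u\<close>.\<close>

lemma ex_const_P:
  assumes "z2_odd u"
  shows "\<exists>p. const_P p \<and> P0 p = u"
proof -
  have "const_P (realise u (0, 0))"
    unfolding const_P_def using sect_realise_ex P0_realise[OF assms] by metis
  then show ?thesis using P0_realise[OF assms] by blast
qed

section \<open>The profinite topology and the closure of the Basilica group\<close>

lemma carrier_tree_aut_UNIV: "carrier (tree_aut UNIV) = range act"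
  by (simp add: carrier_tree_aut)

lemma carrier_M_inf: "carrier M_inf = act ` {p. const_P p}"
  by (auto simp: M_inf_def carrier_tree_aut_UNIV P_map_act const_P_def)

lemma level_fixer_eq: "level_fixer m = act ` {q. agree m q (\<lambda>_. False)}"
proof -
  have "(\<forall>w. length w \<le> m \<longrightarrow> act q w = w) \<longleftrightarrow> agree m q (\<lambda>_. False)" for q
  proof -
    have "agree m q (\<lambda>_. False) \<longleftrightarrow> (\<forall>w. aut_on (T_level m) q w = aut_on (T_level m) (\<lambda>_. False) w)"
      unfolding aut_on_T_level_eq_iff[symmetric] fun_eq_iff ..
    also have "\<dots> \<longleftrightarrow> (\<forall>w. length w \<le> m \<longrightarrow> act q w = w)"
      by (auto simp: aut_on_def T_level_def)
    finally show ?thesis ..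
  qed
  then show ?thesis by (auto simp: level_fixer_def carrier_tree_aut_UNIV)
qed

lemma mult_tree_aut_UNIV [simp]: "mult (tree_aut UNIV) (act p) (act q) = act (mul p q)"
  using aut_on_mul[of UNIV p q] by simp

text \<open>In terms of portraits the basic open sets are the cylinders given by the first
  \<open>m\<close> levels.\<close>

lemma coset_level_fixer: "act p <#\<^bsub>tree_aut UNIV\<^esub> level_fixer m = act ` {q. agree m q p}"
proof
  show "act p <#\<^bsub>tree_aut UNIV\<^esub> level_fixer m \<subseteq> act ` {q. agree m q p}"
    using agree_mul[OF agree_refl, of m _ "\<lambda>_. False" p] by (auto simp: l_coset_def level_fixer_eq)
  show "act ` {q. agree m q p} \<subseteq> act p <#\<^bsub>tree_aut UNIV\<^esub> level_fixer m"
  proof clarify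
    fix q assume q: "agree m q p"
    let ?r = "mul (inv\<^bsub>portrait_group\<^esub> p) q"
    have "agree m ?r (\<lambda>_. False)"
      using agree_mul[OF agree_refl q, of "inv\<^bsub>portrait_group\<^esub> p"] by (simp add: mul_inv)
    moreover have "mul p ?r = q"
      by (simp add: mul_assoc[symmetric] mul_inv)
    ultimately show "act q \<in> act p <#\<^bsub>tree_aut UNIV\<^esub> level_fixer m"
      unfolding l_coset_def level_fixer_eq by force
  qed
qed

lemma aut_topology_eq: "aut_topology = topology_generated_by {act ` {q. agree m q p} | p m. True}"
proof -
  have "{\<sigma> <#\<^bsub>tree_aut UNIV\<^esub> level_fixer m | \<sigma> m. \<sigma> \<in> carrier (tree_aut UNIV)}
      = {act ` {q. agree m q p} | p m. True}"
    unfolding carrier_tree_aut_UNIV using coset_level_fixer by blast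
  then show ?thesis by (simp add: aut_topology_def)
qed

lemma openin_aut_topology_coset: "openin aut_topology (act ` {q. agree m q p})"
  unfolding aut_topology_eq by (rule topology_generated_by_Basis) blast

lemma topspace_aut_topology: "act p \<in> topspace aut_topology"
  using openin_subset[OF openin_aut_topology_coset[of 0 p]] by auto

text \<open>Induction over the generation of the topology: a cylinder is centred at each of its
  points, and an intersection contains the deeper of two cylinders.\<close>

lemma openin_aut_topology_imp:
  assumes "openin aut_topology U" "act p \<in> U"
  shows "\<exists>m. \<forall>q. agree m q p \<longrightarrow> act q \<in> U"
proof -
  have "generate_topology_on {act ` {q. agree m q p} | p m. True} U"
    using assms(1) by (simp add: aut_topology_eq openin_topology_generated_by_iff)
  then show ?thesis using assms(2)
  proof (induction U rule: generate_topology_on.induct)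
    case (Int U V)
    then obtain m n where "\<forall>q. agree m q p \<longrightarrow> act q \<in> U" "\<forall>q. agree n q p \<longrightarrow> act q \<in> V"
      by blast
    then have "\<forall>q. agree (max m n) q p \<longrightarrow> act q \<in> U \<inter> V"
      using agree_mono[of "max m n"] by auto
    then show ?case ..
  next
    case (UN K)
    then show ?case by (meson UnionE UnionI)
  next
    case (Basis U)
    then obtain p' m where "U = act ` {q. agree m q p'}" by blast
    with Basis.prems show ?case
      by (auto simp: act_eq_iff intro!: exI[of _ m] agree_trans[of m _ p p'])
  qed simp
qed

text \<open>The conditions on P are closed, since each congruence involves finitely many levels;
  conversely \<open>basilica_approx\<close> finds elements of the group in every cylinder around
  such an automorphism.\<close>

lemma carrier_B_inf_closure: "carrier B_inf_closure = act ` {p. const_P p \<and> P0 p = 1}"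
proof -
  have "\<sigma> \<in> act ` {p. const_P p \<and> P0 p = 1}" if \<sigma>: "\<sigma> \<in> aut_topology closure_of basilica" for \<sigma>
  proof -
    have "\<sigma> \<in> topspace aut_topology"
      using \<sigma> closure_of_subset_topspace[of aut_topology basilica] by blast
    then obtain p where p: "\<sigma> = act p"
      by (auto simp: aut_topology_eq)
    have "P0 (sect p x) = 1" for x
    proof (rule z2_eqI)
      fix k
      \<comment> \<open>This many levels determine P at the node \<open>x\<close> modulo
        \<open>2 ^ k\<close>.\<close>
      let ?n = "2 * k + length x"
      have "act p \<in> act ` {q. agree ?n q p}" by simp
      moreover have "\<forall>U. act p \<in> U \<and> openin aut_topology U \<longrightarrow> (\<exists>y. y \<in> basilica \<and> y \<in> U)"
        using \<sigma> unfolding p in_closure_of by (rule conjunct2)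
      ultimately have "\<exists>y. y \<in> basilica \<and> y \<in> act ` {q. agree ?n q p}"
        using openin_aut_topology_coset[of ?n p] by simp
      then obtain b where b: "b \<in> port_basilica" "agree ?n b p"
        by (auto simp: basilica_eq act_eq_iff)
      have "P0 (sect b x) = 1"
        using basilica_P b(1) const_P_sect(2)[of b x] by auto
      moreover have "prec ?n x = k" by (simp add: prec_def)
      ultimately show "2 ^ k dvd P0 (sect p x) - 1"
        using P0_sect_agree[OF agree_sym[OF b(2)], of x] by simp
    qed
    moreover from this[of "[]"] have "P0 p = 1" by simp
    ultimately show ?thesis by (simp add: p const_P_def)
  qed
  moreover have "act p \<in> aut_topology closure_of basilica" if p: "const_P p" "P0 p = 1" for p
    unfolding in_closure_of
  proof (intro conjI topspace_aut_topology allI impI)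
    fix U assume "act p \<in> U \<and> openin aut_topology U"
    then obtain m where m: "\<And>q. agree m q p \<Longrightarrow> act q \<in> U"
      using openin_aut_topology_imp by blast
    have "\<exists>b\<in>port_basilica. agree m b p"
      by (rule basilica_approx) (simp add: const_P_sect p)
    with m show "\<exists>y. y \<in> basilica \<and> y \<in> U"
      by (auto simp: basilica_eq)
  qed
  ultimately show ?thesis
    unfolding B_inf_closure_def by auto
qed

section \<open>The exact sequence at infinite level\<close>

lemma mult_M_inf [simp]: "mult M_inf = mult (tree_aut UNIV)"
  and mult_B_inf_closure [simp]: "mult B_inf_closure = mult (tree_aut UNIV)"
  by (simp_all add: M_inf_def B_inf_closure_def)

lemma M_inf_eq: "M_inf = tree_aut UNIV\<lparr>carrier := act ` {p. const_P p}\<rparr>"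
  by (simp add: M_inf_def carrier_M_inf[unfolded M_inf_def, simplified])

lemma B_inf_closure_eq:
  "B_inf_closure = tree_aut UNIV\<lparr>carrier := act ` {p. const_P p \<and> P0 p = 1}\<rparr>"
  by (simp add: B_inf_closure_def carrier_B_inf_closure[unfolded B_inf_closure_def, simplified])

lemma P_act_root: "P_map (act p) [] = P0 p"
  by (simp add: P0_def)

lemma P_image_M_inf: "(\<lambda>\<sigma>. P_map \<sigma> []) ` carrier M_inf = carrier z2_units"
proof
  show "(\<lambda>\<sigma>. P_map \<sigma> []) ` carrier M_inf \<subseteq> carrier z2_units"
    by (auto simp: carrier_M_inf P_act_root carrier_z2_units) (use const_P_inv(2) in blast)
  show "carrier z2_units \<subseteq> (\<lambda>\<sigma>. P_map \<sigma> []) ` carrier M_inf"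
  proof
    fix u assume "u \<in> carrier z2_units"
    then have "z2_odd u" unfolding carrier_z2_units using z2_unit_odd by blast
    then obtain p where "const_P p" "P0 p = u" using ex_const_P by blast
    then show "u \<in> (\<lambda>\<sigma>. P_map \<sigma> []) ` carrier M_inf"
      by (intro image_eqI[of _ _ "act p"]) (simp_all add: carrier_M_inf P_act_root)
  qed
qed

lemma P_hom_M_inf: "(\<lambda>\<sigma>. P_map \<sigma> []) \<in> hom M_inf z2_units"
proof (rule homI)
  show "P_map \<sigma> [] \<in> carrier z2_units" if "\<sigma> \<in> carrier M_inf" for \<sigma>
    using that P_image_M_inf by blast
  show "P_map (\<sigma> \<otimes>\<^bsub>M_inf\<^esub> \<tau>) [] = P_map \<sigma> [] \<otimes>\<^bsub>z2_units\<^esub> P_map \<tau> []"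
    if "\<sigma> \<in> carrier M_inf" "\<tau> \<in> carrier M_inf" for \<sigma> \<tau>
    using that by (auto simp: carrier_M_inf P_act_root P0_mul z2_units_def units_of_def)
qed

lemma short_exact_M_inf:
  "short_exact B_inf_closure (\<lambda>\<sigma>. \<sigma>) M_inf (\<lambda>\<sigma>. P_map \<sigma> []) z2_units"
  unfolding short_exact_def
proof (intro conjI)
  show "group B_inf_closure"
    unfolding B_inf_closure_eq using group_tree_aut_image[OF _ subgroup_P_eq_1, of UNIV] by simp
  show "group M_inf"
    unfolding M_inf_eq using group_tree_aut_image[OF _ subgroup_const_P, of UNIV] by simp
  show "group z2_units" by (rule group_z2_units)
  show "(\<lambda>\<sigma>. \<sigma>) \<in> mon B_inf_closure M_inf"
    by (auto simp: mon_def hom_def carrier_B_inf_closure carrier_M_inf)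
  show "(\<lambda>\<sigma>. P_map \<sigma> []) \<in> epi M_inf z2_units"
    using P_hom_M_inf P_image_M_inf by (simp add: epi_def)
  show "(\<lambda>\<sigma>. \<sigma>) ` carrier B_inf_closure = kernel M_inf z2_units (\<lambda>\<sigma>. P_map \<sigma> [])"
    by (auto simp: kernel_def carrier_B_inf_closure carrier_M_inf P_act_root z2_units_def units_of_def)
qed

section \<open>The groups of finite level\<close>

lemma prec_Nil [simp]: "prec n [] = (n + 1) div 2"
  by (simp add: prec_def)

text \<open>The precision is greatest at the root, so a congruence there passes to the same
  precision at any other node.\<close>

lemma prec_le: "prec n x \<le> prec n []"
  unfolding prec_def by (rule div_le_mono) simp

text \<open>The description by \<open>THE\<close> is meaningful because any two extensions agree on
  the first \<open>n\<close> levels, which determine P at \<open>x\<close> to precision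
  \<open>prec n x\<close>, and \<open>act p\<close> is one extension.\<close>

lemma P_fin_aut_on:
  "P_fin n (aut_on (T_level n) p) x = z2_res (P0 (sect p x)) (prec n x)"
  unfolding P_fin_def
proof (rule the_equality)
  have "z2_res (P0 (sect q x)) (prec n x) = z2_res (P0 (sect p x)) (prec n x)"
    if "restrict (act q) (T_level n) = aut_on (T_level n) p" for q
  proof -
    have "agree n q p" using that by (simp only: aut_on_def[symmetric] aut_on_T_level_eq_iff)
    then show ?thesis by (simp only: z2_res_eq_iff P0_sect_agree)
  qed
  then show "\<forall>\<sigma>\<in>carrier (tree_aut T_inf). restrict \<sigma> (T_level n) = aut_on (T_level n) p
      \<longrightarrow> z2_res (P_map \<sigma> x) (prec n x) = z2_res (P0 (sect p x)) (prec n x)"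
    by (simp add: carrier_tree_aut_UNIV P_map_act)
next
  fix r assume "\<forall>\<sigma>\<in>carrier (tree_aut T_inf). restrict \<sigma> (T_level n) = aut_on (T_level n) p
      \<longrightarrow> z2_res (P_map \<sigma> x) (prec n x) = r"
  then show "r = z2_res (P0 (sect p x)) (prec n x)"
    by (simp add: carrier_tree_aut_UNIV P_map_act aut_on_def)
qed

definition const_P_upto :: "nat \<Rightarrow> portrait \<Rightarrow> bool" where
  "const_P_upto n p \<longleftrightarrow> (\<forall>x. length x \<le> n \<longrightarrow> 2 ^ prec n x dvd P0 (sect p x) - P0 p)"

lemma const_P_upto: "const_P p \<Longrightarrow> const_P_upto n p"
  by (simp add: const_P_upto_def const_P_def)

lemma carrier_M_fin_upto: "carrier (M_fin n) = aut_on (T_level n) ` {p. const_P_upto n p}"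
proof -
  have "[P_fin n (aut_on (T_level n) p) x = P_fin n (aut_on (T_level n) p) []] (mod 2 ^ prec n x)
      \<longleftrightarrow> 2 ^ prec n x dvd P0 (sect p x) - P0 p" for p x
    unfolding P_fin_aut_on cong_def z2_res_mod z2_res_le[OF prec_le] by (simp add: z2_res_eq_iff)
  moreover have "x \<in> T_level n \<longleftrightarrow> length x \<le> n" for x
    by (simp add: T_level_def)
  ultimately show ?thesis
    by (auto simp: M_fin_def carrier_tree_aut const_P_upto_def)
qed

text \<open>Elements of \<open>M_fin n\<close> lift to \<open>M_inf\<close>: a realised portrait
  \<open>m\<close> with the same P at the root is divided off, the quotient has P congruent to 1 and
  is approximated by some \<open>b\<close> in the Basilica group, and \<open>mul m b\<close> is the
  lift.\<close>

lemma const_P_upto_extend: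
  assumes p: "const_P_upto n p"
  shows "\<exists>q. const_P q \<and> P0 q = P0 p \<and> agree n q p"
proof -
  obtain m where m: "const_P m" "P0 m = P0 p"
    using ex_const_P[OF P0_odd] by blast
  let ?i = "inv\<^bsub>portrait_group\<^esub> m"
  have inv: "P0 ?i * P0 p = 1"
    using const_P_inv(2)[OF m(1)] m(2) by (simp add: mult.commute)
  have "\<exists>b\<in>port_basilica. agree n b (mul ?i p)"
  proof (rule basilica_approx)
    fix x :: word assume "length x \<le> n"
    then have "2 ^ prec n x dvd P0 ?i * (P0 (sect p x) - P0 p)"
      using p by (simp add: const_P_upto_def)
    then show "2 ^ prec n x dvd P0 (sect (mul ?i p) x) - 1"
      by (simp add: P0_sect_mul const_P_inv(1)[OF m(1)] right_diff_distrib inv)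
  qed
  then obtain b where b: "b \<in> port_basilica" "agree n b (mul ?i p)" by blast
  have "agree n (mul m b) (mul m (mul ?i p))"
    by (intro agree_mul agree_refl b)
  then have "agree n (mul m b) p"
    by (simp only: mul_assoc[symmetric] mul_inv mul_one)
  moreover have "const_P b" "P0 b = 1" using basilica_P b(1) by auto
  ultimately show ?thesis
    using m by (intro exI[of _ "mul m b"]) (simp add: const_P_mul P0_mul)
qed

text \<open>Thus \<open>M_fin n\<close> is the image of \<open>M_inf\<close>, from which the group
  structure and the multiplicativity of P are inherited.\<close>

lemma carrier_M_fin: "carrier (M_fin n) = aut_on (T_level n) ` {p. const_P p}"
proof
  show "carrier (M_fin n) \<subseteq> aut_on (T_level n) ` {p. const_P p}"
    unfolding carrier_M_fin_upto
  proof clarify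
    fix p assume "const_P_upto n p"
    then obtain q where "const_P q" "agree n q p"
      using const_P_upto_extend by blast
    then show "aut_on (T_level n) p \<in> aut_on (T_level n) ` {p. const_P p}"
      unfolding aut_on_T_level_eq_iff[symmetric] by (metis image_eqI mem_Collect_eq)
  qed
qed (auto simp: carrier_M_fin_upto const_P_upto)

lemma carrier_B_fin: "carrier (B_fin n) = aut_on (T_level n) ` port_basilica"
  by (auto simp: B_fin_def basilica_eq aut_on_def)

lemma mult_M_fin [simp]: "mult (M_fin n) = mult (tree_aut (T_level n))"
  and mult_B_fin [simp]: "mult (B_fin n) = mult (tree_aut (T_level n))"
  by (simp_all add: M_fin_def B_fin_def)

lemma M_fin_eq: "M_fin n = tree_aut (T_level n)\<lparr>carrier := aut_on (T_level n) ` {p. const_P p}\<rparr>"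
  by (simp add: M_fin_def carrier_M_fin[unfolded M_fin_def, simplified])

lemma B_fin_eq: "B_fin n = tree_aut (T_level n)\<lparr>carrier := aut_on (T_level n) ` port_basilica\<rparr>"
  by (simp add: B_fin_def carrier_B_fin[unfolded B_fin_def, simplified])

section \<open>The exact sequence at finite level\<close>

lemma odd_z2_res:
  assumes "z2_odd x" "1 \<le> k"
  shows "odd (z2_res x k)"
  using z2_res_le[OF assms(2), of x] assms(1) by (simp add: odd_iff_mod_2_eq_one)

lemma z2_res_bounds: "0 \<le> z2_res x k" "z2_res x k < 2 ^ k"
  using pos_mod_sign[of "2 ^ k" "z2_res x k"] pos_mod_bound[of "2 ^ k" "z2_res x k"] by simp_all

lemma short_exact_M_fin:
  assumes n: "1 \<le> n"
  shows "short_exact (B_fin n) (\<lambda>\<sigma>. \<sigma>) (M_fin n) (\<lambda>\<tau>. P_fin n \<tau> [])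
           (units_of (residue_ring (2 ^ ((n + 1) div 2))))"
proof -
  define j where "j = (n + 1) div 2"
  have root: "P_fin n (aut_on (T_level n) p) [] = z2_res (P0 p) j" for p
    by (simp add: P_fin_aut_on j_def)
  have j: "1 \<le> j" using n by (simp add: j_def)
  have "(1::int) < 2 ^ j" using j by simp
  then interpret R: residues "2 ^ j" "residue_ring (2 ^ j)"
    by unfold_locales simp_all
  have units: "Units (residue_ring (2 ^ j)) = {x. 0 < x \<and> x < 2 ^ j \<and> odd x}"
    using j by (simp add: R.res_units_eq coprime_power_right_iff)
  have P_units: "z2_res (P0 p) j \<in> Units (residue_ring (2 ^ j))" for p
  proof -
    have "odd (z2_res (P0 p) j)" by (rule odd_z2_res[OF P0_odd j])
    moreover from this have "z2_res (P0 p) j \<noteq> 0" by auto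
    ultimately show ?thesis
      using z2_res_bounds[of "P0 p" j] by (simp add: units)
  qed
  have hom: "(\<lambda>\<tau>. P_fin n \<tau> []) \<in> hom (M_fin n) (units_of (residue_ring (2 ^ j)))"
  proof (rule homI)
    show "P_fin n \<sigma> [] \<in> carrier (units_of (residue_ring (2 ^ j)))" if "\<sigma> \<in> carrier (M_fin n)" for \<sigma>
      using that P_units by (auto simp: carrier_M_fin root units_of_carrier)
    show "P_fin n (\<sigma> \<otimes>\<^bsub>M_fin n\<^esub> \<tau>) [] = P_fin n \<sigma> [] \<otimes>\<^bsub>units_of (residue_ring (2 ^ j))\<^esub> P_fin n \<tau> []"
      if "\<sigma> \<in> carrier (M_fin n)" "\<tau> \<in> carrier (M_fin n)" for \<sigma> \<tau>
    proof -
      from that obtain p q where "\<sigma> = aut_on (T_level n) p" "\<tau> = aut_on (T_level n) q" "const_P p"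
        by (auto simp: carrier_M_fin)
      then show ?thesis
        by (simp add: aut_on_mul root P0_mul z2_res_mult units_of_mult R.res_mult_eq
            del: One_nat_def)
    qed
  qed
  have surj: "(\<lambda>\<tau>. P_fin n \<tau> []) ` carrier (M_fin n) = carrier (units_of (residue_ring (2 ^ j)))"
  proof
    show "(\<lambda>\<tau>. P_fin n \<tau> []) ` carrier (M_fin n) \<subseteq> carrier (units_of (residue_ring (2 ^ j)))"
      using hom by (auto simp: hom_def)
    show "carrier (units_of (residue_ring (2 ^ j))) \<subseteq> (\<lambda>\<tau>. P_fin n \<tau> []) ` carrier (M_fin n)"
    proof
      fix r assume "r \<in> carrier (units_of (residue_ring (2 ^ j)))"
      then have r: "0 < r" "r < 2 ^ j" "odd r" by (simp_all add: units_of_carrier units)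
      \<comment> \<open>The integer \<open>r\<close>, read as a 2-adic number, is odd and hence a
        value of P.\<close>
      then have "z2_odd (of_int r)" by (simp add: z2_res_of_int odd_iff_mod_2_eq_one)
      then obtain p where p: "const_P p" "P0 p = of_int r" using ex_const_P by blast
      have "P_fin n (aut_on (T_level n) p) [] = r"
        using r p(2) by (simp add: root z2_res_of_int del: One_nat_def)
      with p(1) show "r \<in> (\<lambda>\<tau>. P_fin n \<tau> []) ` carrier (M_fin n)"
        unfolding carrier_M_fin by (intro image_eqI[of _ _ "aut_on (T_level n) p"]) simp_all
    qed
  qed
  have ker: "carrier (B_fin n) = kernel (M_fin n) (units_of (residue_ring (2 ^ j))) (\<lambda>\<tau>. P_fin n \<tau> [])"
  proof
    \<comment> \<open>Here \<open>1 \<le> j\<close> matters: modulo \<open>2 ^ 0\<close> the residue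
      of 1 is 0.\<close>
    have one: "z2_res 1 j = 1" using j by (simp add: z2_res_one)
    show "carrier (B_fin n) \<subseteq> kernel (M_fin n) (units_of (residue_ring (2 ^ j))) (\<lambda>\<tau>. P_fin n \<tau> [])"
      using basilica_P one
      by (force simp: kernel_def carrier_B_fin carrier_M_fin root
          units_of_one R.res_one_eq)
    show "kernel (M_fin n) (units_of (residue_ring (2 ^ j))) (\<lambda>\<tau>. P_fin n \<tau> []) \<subseteq> carrier (B_fin n)"
    proof
      fix \<tau> assume "\<tau> \<in> kernel (M_fin n) (units_of (residue_ring (2 ^ j))) (\<lambda>\<tau>. P_fin n \<tau> [])"
      then obtain p where p: "\<tau> = aut_on (T_level n) p" "const_P p" "z2_res (P0 p) j = 1"
        by (auto simp: kernel_def carrier_M_fin root units_of_one R.res_one_eq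
            simp del: One_nat_def)
      then have "z2_res (P0 p) j = z2_res 1 j" by (simp only: one)
      then have dvd: "2 ^ j dvd P0 p - 1" by (simp only: z2_res_eq_iff)
      \<comment> \<open>P is constant on \<open>p\<close>, and no node demands more precision than
        the root.\<close>
      have "\<exists>b\<in>port_basilica. agree n b p"
      proof (rule basilica_approx)
        fix x :: word
        have "prec n x \<le> j" using prec_le[of n x] by (simp add: j_def)
        then have "2 ^ prec n x dvd P0 p - 1"
          using dvd by (meson dvd_trans le_imp_power_dvd)
        then show "2 ^ prec n x dvd P0 (sect p x) - 1"
          by (simp only: const_P_sect(2)[OF p(2)])
      qed
      then show "\<tau> \<in> carrier (B_fin n)"
        unfolding p(1) carrier_B_fin aut_on_T_level_eq_iff[symmetric] by (metis image_eqI)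
    qed
  qed
  have "group (B_fin n)" "group (M_fin n)"
    unfolding B_fin_eq M_fin_eq by (intro group_tree_aut_image subgroup_basilica subgroup_const_P; simp)+
  moreover have "(\<lambda>\<sigma>. \<sigma>) \<in> mon (B_fin n) (M_fin n)"
    using basilica_P by (auto simp: mon_def hom_def carrier_B_fin carrier_M_fin)
  ultimately show ?thesis
    using hom surj ker R.units_group unfolding j_def[symmetric] short_exact_def by (simp add: epi_def)
qed

section \<open>The order of the groups of finite level\<close>

lemma z2_res_eq_mod_iff: "z2_res x k = a mod 2 ^ k \<longleftrightarrow> 2 ^ k dvd x - of_int a"
  using z2_res_eq_iff[of x k "of_int a"] by (simp add: z2_res_of_int)

lemma dvd_diff_z2_res: "2 ^ k dvd x - of_int (z2_res x k)"
  by (simp flip: z2_res_eq_mod_iff)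

lemma z2_residue_unique:
  assumes "2 ^ k dvd x - (of_int a :: z2adic)" "2 ^ k dvd x - of_int b"
    and "0 \<le> a" "a < 2 ^ k" "0 \<le> b" "b < 2 ^ k"
  shows "a = b"
  using assms by (simp flip: z2_res_eq_mod_iff)

lemma dvd_diff_trans: "m dvd x - y \<Longrightarrow> m dvd y - z \<Longrightarrow> m dvd x - (z :: 'a :: comm_ring_1)"
  using dvd_add[of m "x - y" "y - z"] by simp

lemma dvd_diff_sym: "m dvd x - y \<Longrightarrow> m dvd y - (x :: 'a :: comm_ring_1)"
  using dvd_minus_iff[of m "x - y"] by (simp only: minus_diff_eq)

text \<open>Canonical representatives: each automorphism of the tree of depth \<open>n\<close> has
  exactly one portrait that vanishes from level \<open>n\<close> on.\<close>

definition supported :: "nat \<Rightarrow> portrait set" where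
  "supported n = {p. \<forall>x. p x \<longrightarrow> length x < n}"

lemma agree_supported: "p \<in> supported n \<Longrightarrow> q \<in> supported n \<Longrightarrow> agree n p q \<Longrightarrow> p = q"
  by (rule ext) (auto simp: supported_def agree_def)

lemma ex_supported_agree: "\<exists>q\<in>supported n. agree n q p"
  by (rule bexI[of _ "\<lambda>x. length x < n \<and> p x"]) (auto simp: supported_def agree_def)

lemma supported_0: "supported 0 = {\<lambda>_. False}"
  by (auto simp: supported_def)

lemma supported_node: "node b g h \<in> supported (Suc n) \<longleftrightarrow> g \<in> supported n \<and> h \<in> supported n"
proof
  assume *: "node b g h \<in> supported (Suc n)"
  have "length x < n" if "g x" for x
    using * that by (auto simp: supported_def dest: spec[of _ "La # x"])
  moreover have "length x < n" if "h x" for x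
    using * that by (auto simp: supported_def dest: spec[of _ "Lb # x"])
  ultimately show "g \<in> supported n \<and> h \<in> supported n" by (simp add: supported_def)
next
  assume *: "g \<in> supported n \<and> h \<in> supported n"
  have "length x < Suc n" if "node b g h x" for x
  proof (cases x)
    case (Cons s y)
    with * that show ?thesis by (cases s) (auto simp: supported_def)
  qed simp
  then show "node b g h \<in> supported (Suc n)" by (simp add: supported_def)
qed

lemma node_inject [simp]: "node b g h = node b' g' h' \<longleftrightarrow> b = b' \<and> g = g' \<and> h = h'"
proof
  assume eq: "node b g h = node b' g' h'"
  from arg_cong[OF eq, of "\<lambda>p. p []"] arg_cong[OF eq, of "\<lambda>p. sect p [La]"]
    arg_cong[OF eq, of "\<lambda>p. sect p [Lb]"]
  show "b = b' \<and> g = g' \<and> h = h'" by simp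
qed simp

section \<open>Portraits with prescribed residues of P, \<open>Q0\<close> and
  \<open>Q1\<close>\<close>

definition P_congruent :: "nat \<Rightarrow> int \<Rightarrow> portrait \<Rightarrow> bool" where
  "P_congruent n u p \<longleftrightarrow> (\<forall>x. length x \<le> n \<longrightarrow> 2 ^ prec n x dvd P0 (sect p x) - of_int u)"

lemma P_congruent_node:
  "P_congruent (Suc n) u (node b g h) \<longleftrightarrow>
     2 ^ Suc (n div 2) dvd P0 (node b g h) - of_int u \<and> P_congruent n u g \<and> P_congruent n u h"
proof -
  have sect: "sect (node b g h) (La # x) = sect g x" "sect (node b g h) (Lb # x) = sect h x" for x
    by (auto simp: sect_def)
  have all: "(\<forall>x. R x) \<longleftrightarrow> R [] \<and> (\<forall>x. R (La # x)) \<and> (\<forall>x. R (Lb # x))" for R :: "word \<Rightarrow> bool"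
    by (metis letter.exhaust list.exhaust)
  show ?thesis
    unfolding P_congruent_def by (subst all) (simp add: sect)
qed

text \<open>The moduli are the precisions to which \<open>n\<close> levels determine
  \<open>Q0\<close> and \<open>Q1\<close>; refining by these two residues is what makes the count
  recursive.\<close>

definition fibre :: "nat \<Rightarrow> int \<Rightarrow> int \<Rightarrow> int \<Rightarrow> portrait set" where
  "fibre n u c d = {p \<in> supported n. P_congruent n u p
     \<and> 2 ^ ((n + 1) div 2) dvd Q0 p - of_int c \<and> 2 ^ (n div 2) dvd Q1 p - of_int d}"

lemma fibre_P0: "p \<in> fibre n u c d \<Longrightarrow> length x \<le> n \<Longrightarrow> 2 ^ prec n x dvd P0 (sect p x) - of_int u"
  by (simp add: fibre_def P_congruent_def)

text \<open>The recursions for \<open>Q0\<close>, P and \<open>Q1\<close>, solved for the children;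
  oddness of \<open>u\<close> makes \<open>u + 1\<close> and \<open>u - 1\<close> exactly divisible
  by 2.\<close>

lemma node_in_fibre:
  assumes u: "odd u"
  shows "node b0 g h \<in> fibre (Suc n) u c d \<longleftrightarrow>
     b0 = odd c \<and> g \<in> supported n \<and> h \<in> supported n \<and> P_congruent n u g \<and> P_congruent n u h
     \<and> 2 ^ (n div 2) dvd Q1 g - of_int (c div 2)
     \<and> 2 ^ (n div 2) dvd Q1 h - of_int (c div 2 + (if odd c then u + 1 else u - 1) div 2)
     \<and> 2 ^ ((n + 1) div 2) dvd Q0 g + Q0 h - of_int d"
proof -
  let ?c = "c div 2" and ?v = "(if odd c then u + 1 else u - 1) div 2"
  have c: "c = of_bool (odd c) + 2 * ?c"
    by (simp only: of_bool_odd_eq_mod_2 mod_mult_div_eq)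
  have cz: "(of_int c :: z2adic) = of_bool (odd c) + 2 * of_int ?c"
    by (subst c) (simp only: of_int_add of_int_mult of_int_of_bool of_int_numeral)
  have v: "u = (if odd c then - 1 else 1) + 2 * ?v" using u by auto
  have vz: "(of_int u :: z2adic) = (if odd c then - 1 else 1) + 2 * of_int ?v"
    by (subst v) (simp only: of_int_add of_int_mult of_int_numeral if_distrib[of of_int] of_int_minus of_int_1)
  have Q0: "2 ^ Suc (n div 2) dvd Q0 (node b0 g h) - of_int c \<longleftrightarrow>
      b0 = odd c \<and> 2 ^ (n div 2) dvd Q1 g - of_int ?c"
  proof (cases "b0 = odd c")
    case True
    have "Q0 (node b0 g h) - of_int c = 2 * (Q1 g - of_int ?c)"
      by (simp add: Q0_rec True cz algebra_simps)
    with True show ?thesis by (simp only: pow2_Suc_dvd_double) simp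
  next
    case False
    have "Q0 (node b0 g h) - of_int c = (if b0 then 1 else - 1) + 2 * (Q1 g - of_int ?c)"
      using False by (cases b0) (simp_all add: Q0_rec cz algebra_simps)
    \<comment> \<open>A root parity other than that of \<open>c\<close> leaves an odd
      difference.\<close>
    moreover have "\<not> 2 dvd (if b0 then 1 else - 1) + 2 * (Q1 g - of_int ?c)"
    proof
      assume "2 dvd (if b0 then 1 else - 1) + 2 * (Q1 g - of_int ?c)"
      then have "2 ^ 1 dvd ((if b0 then 1 else - 1) :: z2adic)"
        by (simp add: dvd_add_left_iff)
      then have "2 ^ 1 dvd (1 :: z2adic)" by (cases b0) (simp_all add: minus_dvd_iff)
      then show False by (simp only: z2_res_eq_0_iff[symmetric]) (simp add: z2_res_one)
    qed
    ultimately have "\<not> 2 ^ Suc (n div 2) dvd Q0 (node b0 g h) - of_int c"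
      by (metis dvd_trans dvd_triv_left power_Suc)
    with False show ?thesis by simp
  qed
  have P0: "2 ^ Suc (n div 2) dvd P0 (node b0 g h) - of_int u \<longleftrightarrow> 2 ^ (n div 2) dvd Q1 h - of_int (?c + ?v)"
    if "b0 = odd c" and g: "2 ^ (n div 2) dvd Q1 g - of_int ?c"
  proof -
    have "P0 (node b0 g h) - of_int u = 2 * ((Q1 h - of_int (?c + ?v)) - (Q1 g - of_int ?c))"
      by (simp add: P0_rec \<open>b0 = odd c\<close> vz algebra_simps)
    then have "2 ^ Suc (n div 2) dvd P0 (node b0 g h) - of_int u
        \<longleftrightarrow> 2 ^ (n div 2) dvd (Q1 h - of_int (?c + ?v)) - (Q1 g - of_int ?c)"
      by (simp only: pow2_Suc_dvd_double)
    also have "\<dots> \<longleftrightarrow> 2 ^ (n div 2) dvd Q1 h - of_int (?c + ?v)"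
      using dvd_diff[OF _ g, of "Q1 h - of_int (?c + ?v)"] dvd_add[OF _ g, of "(Q1 h - of_int (?c + ?v)) - (Q1 g - of_int ?c)"]
      by (metis diff_add_cancel)
    finally show ?thesis .
  qed
  have "(Suc n + 1) div 2 = Suc (n div 2)" "Suc n div 2 = (n + 1) div 2" by simp_all
  then have "node b0 g h \<in> fibre (Suc n) u c d \<longleftrightarrow> g \<in> supported n \<and> h \<in> supported n
      \<and> 2 ^ Suc (n div 2) dvd P0 (node b0 g h) - of_int u \<and> P_congruent n u g \<and> P_congruent n u h
      \<and> 2 ^ Suc (n div 2) dvd Q0 (node b0 g h) - of_int c
      \<and> 2 ^ ((n + 1) div 2) dvd Q0 g + Q0 h - of_int d"
    by (simp only: fibre_def mem_Collect_eq supported_node P_congruent_node Q1_def sect_node conj_assoc)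
  then show ?thesis using Q0 P0 by blast
qed

text \<open>Binary logarithm of the size of a fibre for odd \<open>u\<close>: one free residue
  modulo \<open>2 ^ ((n + 1) div 2)\<close> and a fibre on each of the two children.\<close>

fun fibre_exponent :: "nat \<Rightarrow> nat" where
  "fibre_exponent 0 = 0"
| "fibre_exponent (Suc n) = (n + 1) div 2 + 2 * fibre_exponent n"

text \<open>Here \<open>c\<close> determines the root and the residues of \<open>Q1\<close> on both children, whereas only the sum
  of the two residues of \<open>Q0\<close> is prescribed: this leaves the free parameter \<open>e\<close>.\<close>

lemma fibre_Suc:
  assumes u: "odd u"
  shows "fibre (Suc n) u c d = (\<Union>e\<in>{0..<2 ^ ((n + 1) div 2)}. (\<lambda>(g, h). node (odd c) g h) `
    (fibre n u e (c div 2) \<times> fibre n u (d - e) (c div 2 + (if odd c then u + 1 else u - 1) div 2)))"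
  (is "_ = (\<Union>e\<in>?E. ?N ` (?G e \<times> ?H e))")
proof
  show "fibre (Suc n) u c d \<subseteq> (\<Union>e\<in>?E. ?N ` (?G e \<times> ?H e))"
  proof
    fix p assume p: "p \<in> fibre (Suc n) u c d"
    obtain b g h where p_eq: "p = node b g h" by (metis node_eta)
    let ?e = "z2_res (Q0 g) ((n + 1) div 2)"
    note mem = p[unfolded p_eq, unfolded node_in_fibre[OF u]]
    have "2 ^ ((n + 1) div 2) dvd (Q0 g + Q0 h - of_int d) - (Q0 g - of_int ?e)"
      using mem by (blast intro: dvd_diff dvd_diff_z2_res)
    then have "2 ^ ((n + 1) div 2) dvd Q0 h - of_int (d - ?e)"
      by (simp add: algebra_simps)
    then have "(g, h) \<in> ?G ?e \<times> ?H ?e"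
      using mem dvd_diff_z2_res[of "(n + 1) div 2" "Q0 g"] by (simp add: fibre_def)
    moreover have "p = ?N (g, h)" using mem p_eq by simp
    moreover have "?e \<in> ?E" by (simp add: z2_res_bounds)
    ultimately show "p \<in> (\<Union>e\<in>?E. ?N ` (?G e \<times> ?H e))" by blast
  qed
  show "(\<Union>e\<in>?E. ?N ` (?G e \<times> ?H e)) \<subseteq> fibre (Suc n) u c d"
  proof clarify
    fix e g h assume g: "g \<in> ?G e" and h: "h \<in> ?H e"
    then have "2 ^ ((n + 1) div 2) dvd (Q0 g - of_int e) + (Q0 h - of_int (d - e))"
      by (intro dvd_add) (simp_all add: fibre_def)
    then have "2 ^ ((n + 1) div 2) dvd Q0 g + Q0 h - of_int d"
      by (simp add: algebra_simps)
    with g h show "node (odd c) g h \<in> fibre (Suc n) u c d"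
      unfolding node_in_fibre[OF u] by (simp add: fibre_def)
  qed
qed

text \<open>The union over \<open>e\<close> is disjoint because \<open>e\<close> is the residue of
  \<open>Q0 g\<close>, and the child fibres have a size independent of the prescribed residues. At
  \<open>n = 0\<close> all moduli are 1, so the fibre is a single portrait.\<close>

lemma card_fibre:
  assumes u: "odd u"
  shows "finite (fibre n u c d) \<and> card (fibre n u c d) = 2 ^ fibre_exponent n"
proof (induction n arbitrary: c d)
  case 0
  have "fibre 0 u c d = {\<lambda>_. False}"
    by (auto simp: fibre_def supported_0 P_congruent_def)
  then show ?case by simp
next
  case (Suc n)
  let ?E = "{0..<2 ^ ((n + 1) div 2)} :: int set" and ?N = "\<lambda>(g, h). node (odd c) g h"
  let ?G = "\<lambda>e. fibre n u e (c div 2)"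
    and ?H = "\<lambda>e. fibre n u (d - e) (c div 2 + (if odd c then u + 1 else u - 1) div 2)"
  have inj: "inj_on ?N A" for A by (auto simp: inj_on_def)
  have fin: "\<forall>e\<in>?E. finite (?N ` (?G e \<times> ?H e))" using Suc.IH by blast
  have disj: "\<forall>e\<in>?E. \<forall>e'\<in>?E. e \<noteq> e' \<longrightarrow> ?N ` (?G e \<times> ?H e) \<inter> ?N ` (?G e' \<times> ?H e') = {}"
  proof (intro ballI impI, rule ccontr)
    fix e e' assume e: "e \<in> ?E" "e' \<in> ?E" "e \<noteq> e'"
      and "?N ` (?G e \<times> ?H e) \<inter> ?N ` (?G e' \<times> ?H e') \<noteq> {}"
    then obtain g where "g \<in> ?G e" "g \<in> ?G e'" by auto
    then show False
      using e z2_residue_unique[of "(n + 1) div 2" "Q0 g" e e'] by (simp add: fibre_def)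
  qed
  have "card (fibre (Suc n) u c d) = (\<Sum>e\<in>?E. card (?N ` (?G e \<times> ?H e)))"
    unfolding fibre_Suc[OF u] by (rule card_UN_disjoint[OF _ fin disj]) simp
  also have "\<dots> = (\<Sum>e\<in>?E. 2 ^ fibre_exponent n * 2 ^ fibre_exponent n)"
    using Suc.IH by (intro sum.cong) (simp_all add: card_image[OF inj] card_cartesian_product)
  also have "\<dots> = 2 ^ fibre_exponent (Suc n)"
    by (simp add: nat_power_eq power_add mult_2)
  finally show ?case
    unfolding fibre_Suc[OF u] using fin by blast
qed

section \<open>Summation over the fibres\<close>

lemma const_P_upto_agree:
  assumes "agree n p q" "const_P_upto n p"
  shows "const_P_upto n q"
  unfolding const_P_upto_def
proof (intro allI impI)
  fix x :: word assume x: "length x \<le> n"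
  have "2 ^ prec n x dvd P0 (sect q x) - P0 (sect p x)"
    by (rule P0_sect_agree[OF agree_sym[OF assms(1)]])
  moreover have "2 ^ prec n x dvd P0 (sect p x) - P0 p"
    using assms(2) x by (simp add: const_P_upto_def)
  moreover have "2 ^ prec n x dvd P0 p - P0 q"
    using dvd_trans[OF le_imp_power_dvd[OF prec_le] P0_sect_agree[OF assms(1), of "[]"]] by simp
  ultimately show "2 ^ prec n x dvd P0 (sect q x) - P0 q"
    by (blast intro: dvd_diff_trans)
qed

lemma card_carrier_M_fin_supported:
  "card (carrier (M_fin n)) = card {p \<in> supported n. const_P_upto n p}"
proof -
  have "inj_on (aut_on (T_level n)) {p \<in> supported n. const_P_upto n p}"
    by (rule inj_onI) (auto simp: aut_on_T_level_eq_iff intro: agree_supported)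
  moreover have "aut_on (T_level n) ` {p \<in> supported n. const_P_upto n p} = carrier (M_fin n)"
    unfolding carrier_M_fin_upto
  proof (intro equalityI subsetI)
    fix \<tau> assume "\<tau> \<in> aut_on (T_level n) ` {p. const_P_upto n p}"
    then obtain p where p: "const_P_upto n p" "\<tau> = aut_on (T_level n) p" by blast
    obtain q where q: "q \<in> supported n" "agree n q p" using ex_supported_agree by blast
    then have "const_P_upto n q" using const_P_upto_agree[OF agree_sym] p(1) by blast
    moreover have "\<tau> = aut_on (T_level n) q"
      using p(2) q(2) by (simp add: aut_on_T_level_eq_iff agree_sym)
    ultimately show "\<tau> \<in> aut_on (T_level n) ` {p \<in> supported n. const_P_upto n p}"
      using q(1) by blast
  qed auto
  ultimately show ?thesis by (metis card_image)
qed

lemma card_odd_residues: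
  assumes "1 \<le> j"
  shows "card {u :: int. 0 \<le> u \<and> u < 2 ^ j \<and> odd u} = 2 ^ (j - 1)"
proof -
  obtain i where j: "j = Suc i" using assms by (cases j) auto
  have "{u :: int. 0 \<le> u \<and> u < 2 ^ j \<and> odd u} = (\<lambda>v. 2 * v + 1) ` {0..<2 ^ i}"
    by (auto simp: j elim!: oddE)
  then show ?thesis
    by (simp add: card_image inj_on_def j nat_power_eq)
qed

text \<open>Each portrait is sorted by its own residues; \<open>1 \<le> n\<close> makes the modulus
  for P even, so that the residue of P is odd.\<close>

lemma const_P_upto_fibres:
  assumes n: "1 \<le> n"
  shows "{p \<in> supported n. const_P_upto n p} = (\<Union>(u, c, d)\<in>
    {u. 0 \<le> u \<and> u < 2 ^ ((n + 1) div 2) \<and> odd u} \<times> {0..<2 ^ ((n + 1) div 2)} \<times> {0..<2 ^ (n div 2)}.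
    fibre n u c d)"
  (is "?A = (\<Union>(u, c, d)\<in>?U \<times> ?C \<times> ?D. _)")
proof (intro equalityI subsetI)
  fix p assume "p \<in> ?A"
  then have p: "p \<in> supported n" "const_P_upto n p" by simp_all
  let ?u = "z2_res (P0 p) ((n + 1) div 2)"
    and ?c = "z2_res (Q0 p) ((n + 1) div 2)" and ?d = "z2_res (Q1 p) (n div 2)"
  have "P_congruent n ?u p"
    unfolding P_congruent_def
  proof (intro allI impI)
    fix x :: word assume x: "length x \<le> n"
    have "2 ^ prec n x dvd P0 p - of_int ?u"
      using dvd_trans[OF le_imp_power_dvd[OF prec_le[of n x]] dvd_diff_z2_res[of _ "P0 p"]] by simp
    then show "2 ^ prec n x dvd P0 (sect p x) - of_int ?u"
      using p(2) x dvd_diff_trans unfolding const_P_upto_def by blast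
  qed
  then have "p \<in> fibre n ?u ?c ?d"
    using p(1) by (simp add: fibre_def dvd_diff_z2_res)
  moreover have "?u \<in> ?U" "?c \<in> ?C" "?d \<in> ?D"
    using odd_z2_res[OF P0_odd[of p], of "(n + 1) div 2"] n by (simp_all add: z2_res_bounds)
  ultimately show "p \<in> (\<Union>(u, c, d)\<in>?U \<times> ?C \<times> ?D. fibre n u c d)" by blast
next
  fix p assume "p \<in> (\<Union>(u, c, d)\<in>?U \<times> ?C \<times> ?D. fibre n u c d)"
  then obtain u c d where p: "p \<in> fibre n u c d" by blast
  have "2 ^ prec n x dvd P0 (sect p x) - P0 p" if x: "length x \<le> n" for x
  proof -
    have "2 ^ prec n x dvd P0 (sect p []) - of_int u"
      using dvd_trans[OF le_imp_power_dvd[OF prec_le] fibre_P0[OF p, of "[]"]] by simp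
    from dvd_diff_trans[OF fibre_P0[OF p x] dvd_diff_sym[OF this]] show ?thesis by simp
  qed
  with p show "p \<in> ?A" by (simp add: fibre_def const_P_upto_def)
qed

text \<open>With \<open>j = (n + 1) div 2\<close> there are \<open>2 ^ (j - 1)\<close> odd residues
  for P, and \<open>2 ^ j * 2 ^ (n div 2) = 2 ^ n\<close> pairs of residues for \<open>Q0\<close>
  and \<open>Q1\<close>.\<close>

lemma card_carrier_M_fin:
  assumes n: "1 \<le> n"
  shows "card (carrier (M_fin n)) = 2 ^ ((n + 1) div 2 - 1 + n + fibre_exponent n)"
proof -
  define j where "j = (n + 1) div 2"
  have j: "1 \<le> j" using n by (simp add: j_def)
  define I :: "(int \<times> int \<times> int) set" where
    "I = {u. 0 \<le> u \<and> u < 2 ^ j \<and> odd u} \<times> {0..<2 ^ j} \<times> {0..<2 ^ (n div 2)}"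
  have "finite {u :: int. 0 \<le> u \<and> u < 2 ^ j \<and> odd u}"
    by (rule finite_subset[of _ "{0..<2 ^ j}"]) auto
  then have I: "finite I" "card I = 2 ^ (j - 1) * (2 ^ j * 2 ^ (n div 2))"
    by (simp_all add: I_def card_cartesian_product card_odd_residues[OF j] nat_power_eq)
  let ?F = "\<lambda>(u, c, d). fibre n u c d"
  have fin: "\<forall>i\<in>I. finite (?F i)" and card: "card (?F i) = 2 ^ fibre_exponent n" if "i \<in> I" for i
    using that card_fibre by (auto simp: I_def)
  have disj: "\<forall>i\<in>I. \<forall>i'\<in>I. i \<noteq> i' \<longrightarrow> ?F i \<inter> ?F i' = {}"
  proof (intro ballI impI, rule ccontr)
    fix i i' assume i: "i \<in> I" "i' \<in> I" "i \<noteq> i'" "?F i \<inter> ?F i' \<noteq> {}"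
    obtain u c d u' c' d' where eq: "i = (u, c, d)" "i' = (u', c', d')" by (metis prod_cases3)
    with i obtain p where p: "p \<in> fibre n u c d" "p \<in> fibre n u' c' d'" by auto
    have P: "2 ^ j dvd P0 p - of_int v" if "p \<in> fibre n v e f" for v e f
      using fibre_P0[OF that, of "[]"] by (simp add: j_def)
    have "u = u'"
      using z2_residue_unique[OF P[OF p(1)] P[OF p(2)]] i by (auto simp: I_def eq)
    moreover have "c = c'"
      using z2_residue_unique[of j "Q0 p" c c'] p i by (auto simp: I_def eq fibre_def j_def)
    moreover have "d = d'"
      using z2_residue_unique[of "n div 2" "Q1 p" d d'] p i by (auto simp: I_def eq fibre_def)
    ultimately show False using i eq by simp
  qed
  have "card (carrier (M_fin n)) = card (\<Union>i\<in>I. ?F i)"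
    unfolding card_carrier_M_fin_supported const_P_upto_fibres[OF n] I_def j_def ..
  also have "\<dots> = (\<Sum>i\<in>I. card (?F i))"
    by (rule card_UN_disjoint[OF I(1) _ disj]) (use fin in blast)
  also have "\<dots> = card I * 2 ^ fibre_exponent n"
    using card by simp
  also have "\<dots> = 2 ^ (j - 1 + (j + n div 2) + fibre_exponent n)"
    by (simp add: I(2) power_add)
  also have "j + n div 2 = n" by (simp add: j_def)
  finally show ?thesis by (simp add: j_def)
qed

lemma fibre_exponent_eq:
  "real (fibre_exponent n) = 2 ^ (n + 1) / 3 - real ((n + 1) div 2) - (if even n then 2 / 3 else 1 / 3)"
proof (induction n)
  case (Suc n)
  have "real (fibre_exponent (Suc n)) = real ((n + 1) div 2) + 2 * real (fibre_exponent n)"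
    by (simp only: fibre_exponent.simps of_nat_add of_nat_mult of_nat_numeral)
  also have "\<dots> = 2 ^ (Suc n + 1) / 3 - real ((n + 1) div 2) - (if even n then 4 / 3 else 2 / 3)"
    unfolding Suc.IH by simp
  \<comment> \<open>For even \<open>n\<close> the rounded half increases by 1, which turns
    \<open>4 / 3\<close> into \<open>1 / 3\<close>; for odd \<open>n\<close> it stays the
    same.\<close>
  also have "\<dots> = 2 ^ (Suc n + 1) / 3 - real ((Suc n + 1) div 2) - (if even (Suc n) then 2 / 3 else 1 / 3)"
    by (auto elim!: evenE oddE)
  finally show ?case .
qed simp

theorem theorem4p6:
  shows "(\<lambda>\<sigma>. P_map \<sigma> []) \<in> hom M_inf z2_units
    \<and> (\<lambda>\<sigma>. P_map \<sigma> []) ` carrier M_inf = carrier z2_units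
    \<and> short_exact B_inf_closure (\<lambda>\<sigma>. \<sigma>) M_inf (\<lambda>\<sigma>. P_map \<sigma> []) z2_units
    \<and> (\<forall>n\<ge>1.
         short_exact (B_fin n) (\<lambda>\<sigma>. \<sigma>) (M_fin n) (\<lambda>\<tau>. P_fin n \<tau> [])
           (units_of (residue_ring (2 ^ ((n + 1) div 2))))
       \<and> real (card (carrier (M_fin n))) =
           2 powr (2 ^ (n + 1) / 3 + real n - (if even n then 5 / 3 else 4 / 3)))"
proof (intro conjI allI impI)
  fix n :: nat assume n: "n \<ge> 1"
  then show "short_exact (B_fin n) (\<lambda>\<sigma>. \<sigma>) (M_fin n) (\<lambda>\<tau>. P_fin n \<tau> [])
      (units_of (residue_ring (2 ^ ((n + 1) div 2))))"
    by (rule short_exact_M_fin)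
  have "real (card (carrier (M_fin n))) = 2 powr real ((n + 1) div 2 - 1 + n + fibre_exponent n)"
    by (simp only: card_carrier_M_fin[OF n] powr_realpow) simp
  also have "real ((n + 1) div 2 - 1 + n + fibre_exponent n)
      = real ((n + 1) div 2) - 1 + real n + real (fibre_exponent n)"
    using n by (simp add: of_nat_diff)
  \<comment> \<open>The terms \<open>(n + 1) div 2\<close> cancel, and the 1 lost by restricting to
    odd residues turns \<open>2 / 3\<close> and \<open>1 / 3\<close> into \<open>5 / 3\<close> and
    \<open>4 / 3\<close>.\<close>
  also have "\<dots> = 2 ^ (n + 1) / 3 + real n - (if even n then 5 / 3 else 4 / 3)"
    by (simp add: fibre_exponent_eq)
  finally show "real (card (carrier (M_fin n))) =
      2 powr (2 ^ (n + 1) / 3 + real n - (if even n then 5 / 3 else 4 / 3))" .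
qed (fact P_hom_M_inf P_image_M_inf short_exact_M_inf)+

end
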